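(* Fix $T>0$, let $u\in L^\infty_{\mathrm{loc}}([0,T);W^{1,\infty}(\mathbb{T}^d))$ be divergence free, and let $\theta_0\in H^2(\mathbb{T}^d)$ be mean zero and not identically zero. For $\kappa>0$ let $\theta^\kappa$ be the solution of $\partial_t\theta^\kappa+u\cdot\nabla\theta^\kappa=\kappa\Delta\theta^\kappa$, and let $\theta$ be the solution of $\partial_t\theta+u\cdot\nabla\theta=0$, both with initial data $\theta_0$ (independent of $\kappa$). Suppose there is a constant $C\ge1$, independent of $\kappa$ and $t$, such that for all $t\in[0,T)$ $$|\theta(t)|_{\dot H^2}\le\frac{C\,|\theta(t)|_{\dot H^1}^2}{|\theta_0|_{L^2}},\qquad \frac{1}{C(T-t)}\le\frac{|\theta(t)|_{\dot H^1}}{|\theta_0|_{L^2}},\qquad |\nabla u(t)|_{L^\infty}\le\frac{C}{T-t}.$$ Then there exists $\chi>0$, depending only on $C$, such that for all $\kappa>0$ $$\kappa\int_0^T|\nabla\theta^\kappa|_{L^2}^2\,\mathrm{d}t\ >\ \chi\,|\theta_0|_{L^2}^2 .$$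
   Context: $d\ge2$ and $\mathbb{T}^d=(\mathbb{R}/2\pi\mathbb{Z})^d$. Norms: $|f|_{L^2}=(\int_{\mathbb{T}^d}|f|^2\,\mathrm{d}x)^{1/2}$, $|f|_{\dot H^1}^2=|\nabla f|_{L^2}^2=\sum_i|\partial_i f|_{L^2}^2$, $|f|_{\dot H^2}^2=\sum_{i,j}|\partial_i\partial_j f|_{L^2}^2$. "Mean zero" means $\int_{\mathbb{T}^d}\theta_0\,\mathrm{d}x=0$. $T>0$ and the dimension $d$ are fixed throughout. *)

theory Defs
  imports "HOL-Analysis.Analysis" "HOL-Probability.Essential_Supremum"
begin

text \<open>
  A function on the torus \<open>(\<real> / 2\<pi>\<int>)^n\<close> is a function on \<open>\<real>^n\<close> that is \<open>2\<pi>\<close>-periodic in every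
  coordinate; integrals are taken over the fundamental domain \<open>[0, 2\<pi>]^n\<close>, whose boundary is null.
\<close>

definition periodic :: "((real ^ 'n) \<Rightarrow> 'b) \<Rightarrow> bool" where
  "periodic f \<longleftrightarrow> (\<forall>x i. f (x + axis i (2 * pi)) = f x)"

definition torus :: "(real ^ 'n) measure" where
  "torus = restrict_space lborel (cbox 0 (\<chi> i. 2 * pi))"


subsection \<open>Smooth test functions\<close>

definition grad :: "((real ^ 'n) \<Rightarrow> real) \<Rightarrow> real ^ 'n \<Rightarrow> real ^ 'n" where
  "grad \<phi> x = (\<chi> i. frechet_derivative \<phi> (at x) (axis i 1))"

fun continuously_differentiable :: "nat \<Rightarrow> ((real ^ 'n) \<Rightarrow> real) \<Rightarrow> bool" where
  "continuously_differentiable 0 \<phi> \<longleftrightarrow> continuous_on UNIV \<phi>"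
| "continuously_differentiable (Suc k) \<phi> \<longleftrightarrow>
     (\<forall>x. \<phi> differentiable (at x)) \<and> (\<forall>i. continuously_differentiable k (\<lambda>x. grad \<phi> x $ i))"

definition test_functions :: "((real ^ 'n) \<Rightarrow> real) set" where
  "test_functions = {\<phi>. periodic \<phi> \<and> (\<forall>k. continuously_differentiable k \<phi>)}"


subsection \<open>Lebesgue and Sobolev spaces\<close>

definition L2 :: "((real ^ 'n) \<Rightarrow> real) set" where
  "L2 = {f. periodic f \<and> f \<in> borel_measurable torus \<and> integrable torus (\<lambda>x. (f x)\<^sup>2)}"

definition L2_norm :: "((real ^ 'n) \<Rightarrow> real) \<Rightarrow> real" where
  "L2_norm f = sqrt (LINT x|torus. (f x)\<^sup>2)"

definition Linf_norm :: "((real ^ 'n) \<Rightarrow> 'b::real_normed_vector) \<Rightarrow> ennreal" where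
  "Linf_norm f = esssup torus (\<lambda>x. ennreal (norm (f x)))"

definition has_weak_partial ::
    "'n \<Rightarrow> ((real ^ 'n) \<Rightarrow> real) \<Rightarrow> ((real ^ 'n) \<Rightarrow> real) \<Rightarrow> bool" where
  "has_weak_partial i f g \<longleftrightarrow>
     periodic f \<and> integrable torus f \<and> periodic g \<and> integrable torus g \<and>
     (\<forall>\<phi>\<in>test_functions. (LINT x|torus. f x * grad \<phi> x $ i) = - (LINT x|torus. g x * \<phi> x))"

text \<open>
  Weak derivatives are determined only almost everywhere; \<open>weak_partial i f\<close> is an arbitrary
  representative, and it is meaningful only if a weak derivative exists.
\<close>

definition weak_partial :: "'n \<Rightarrow> ((real ^ 'n) \<Rightarrow> real) \<Rightarrow> ((real ^ 'n) \<Rightarrow> real)" where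
  "weak_partial i f = (SOME g. has_weak_partial i f g)"

definition weak_grad :: "((real ^ 'n) \<Rightarrow> real) \<Rightarrow> real ^ 'n \<Rightarrow> real ^ 'n" where
  "weak_grad f x = (\<chi> i. weak_partial i f x)"

definition H1 :: "((real ^ 'n) \<Rightarrow> real) set" where
  "H1 = {f \<in> L2. \<forall>i. \<exists>g\<in>L2. has_weak_partial i f g}"

definition H2 :: "((real ^ 'n) \<Rightarrow> real) set" where
  "H2 = {f \<in> H1. \<forall>i. weak_partial i f \<in> H1}"

definition H1_seminorm :: "((real ^ 'n) \<Rightarrow> real) \<Rightarrow> real" where
  "H1_seminorm f = sqrt (\<Sum>i\<in>UNIV. (L2_norm (weak_partial i f))\<^sup>2)"

definition H2_seminorm :: "((real ^ 'n) \<Rightarrow> real) \<Rightarrow> real" where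
  "H2_seminorm f = sqrt (\<Sum>i\<in>UNIV. \<Sum>j\<in>UNIV. (L2_norm (weak_partial i (weak_partial j f)))\<^sup>2)"


subsection \<open>Vector fields\<close>

text \<open>
  Row \<open>j\<close> of the weak Jacobian is the weak gradient of the \<open>j\<close>-th component. The norm on
  \<open>real ^ 'n ^ 'n\<close> is the Frobenius norm, so \<open>Linf_norm (weak_jacobian v)\<close> is the essential supremum
  of the square root of the sum of the \<open>(\<partial>\<^sub>i v\<^sub>j)\<^sup>2\<close>.
\<close>

definition weak_jacobian :: "(real ^ 'n \<Rightarrow> real ^ 'n) \<Rightarrow> real ^ 'n \<Rightarrow> real ^ 'n ^ 'n" where
  "weak_jacobian v x = (\<chi> j. weak_grad (\<lambda>y. v y $ j) x)"

definition W1inf :: "(real ^ 'n \<Rightarrow> real ^ 'n) set" where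
  "W1inf = {v. (\<forall>i j. \<exists>g. has_weak_partial i (\<lambda>y. v y $ j) g) \<and>
               Linf_norm v < \<infinity> \<and> Linf_norm (weak_jacobian v) < \<infinity>}"

text \<open>
  The space \<open>L\<^sup>\<infinity>\<^sub>l\<^sub>o\<^sub>c([0,T); W\<^sup>1\<^sup>,\<^sup>\<infinity>)\<close>. Since \<open>W\<^sup>1\<^sup>,\<^sup>\<infinity>\<close> is not separable, measurability in time
  means, as usual, joint measurability in time and space.
\<close>

definition Linf_loc_W1inf :: "real \<Rightarrow> (real \<Rightarrow> real ^ 'n \<Rightarrow> real ^ 'n) \<Rightarrow> bool" where
  "Linf_loc_W1inf T u \<longleftrightarrow>
     (\<lambda>(t, x). u t x) \<in> borel_measurable (restrict_space borel ({0..<T} \<times> UNIV)) \<and>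
     (\<forall>s\<in>{0..<T}. \<exists>M::real. AE t in lborel. t \<in> {0..s} \<longrightarrow>
        u t \<in> W1inf \<and> Linf_norm (u t) \<le> ennreal M \<and> Linf_norm (weak_jacobian (u t)) \<le> ennreal M)"

definition divergence_free :: "real \<Rightarrow> (real \<Rightarrow> real ^ 'n \<Rightarrow> real ^ 'n) \<Rightarrow> bool" where
  "divergence_free T u \<longleftrightarrow>
     (AE t in lborel. t \<in> {0..<T} \<longrightarrow>
        (AE x in torus. (\<Sum>i\<in>UNIV. weak_partial i (\<lambda>y. u t y $ i) x) = 0))"


subsection \<open>Solutions\<close>

text \<open>
  Solutions of \<open>\<partial>\<^sub>t \<theta> + u \<cdot> \<nabla>\<theta> = \<kappa> \<Delta>\<theta>\<close> on \<open>[0, T)\<close> with initial datum \<open>\<theta>\<^sub>0\<close> are weak solutions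
  in the class \<open>C([0,T); L\<^sup>2) \<inter> L\<^sup>2\<^sub>l\<^sub>o\<^sub>c([0,T); H\<^sup>1)\<close>; \<open>\<kappa> = 0\<close> is the transport equation. For \<open>\<kappa> \<ge> 0\<close>,
  \<open>\<theta>\<^sub>0 \<in> H\<^sup>1\<close> and divergence free \<open>u \<in> L\<^sup>\<infinity>\<^sub>l\<^sub>o\<^sub>c([0,T); W\<^sup>1\<^sup>,\<^sup>\<infinity>)\<close> there is exactly one such solution
  (as a curve in \<open>L\<^sup>2\<close>). The equation is tested against functions of the space variable
  and integrated over \<open>[0, t]\<close>. The integrability of the paired equation in time follows from
  the regularity of \<open>u\<close> and \<open>\<theta>\<close>; it is included to make the integral visibly well defined.
\<close>

definition is_solution ::
    "real \<Rightarrow> real \<Rightarrow> (real \<Rightarrow> real ^ 'n \<Rightarrow> real ^ 'n) \<Rightarrow> (real ^ 'n \<Rightarrow> real) \<Rightarrow>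
     (real \<Rightarrow> real ^ 'n \<Rightarrow> real) \<Rightarrow> bool" where
  "is_solution T \<kappa> u \<theta>\<^sub>0 \<theta> \<longleftrightarrow>
     (\<forall>t\<in>{0..<T}. \<theta> t \<in> L2 \<and>
        ((\<lambda>s. L2_norm (\<lambda>x. \<theta> s x - \<theta> t x)) \<longlongrightarrow> 0) (at t within {0..<T})) \<and>
     (AE t in lborel. t \<in> {0..<T} \<longrightarrow> \<theta> t \<in> H1) \<and>
     (\<forall>s\<in>{0..<T}. set_integrable lborel {0..s} (\<lambda>t. (H1_seminorm (\<theta> t))\<^sup>2)) \<and>
     (AE x in torus. \<theta> 0 x = \<theta>\<^sub>0 x) \<and>
     (\<forall>\<phi>\<in>test_functions. \<forall>t\<in>{0..<T}.
        let pairing = (\<lambda>s. (LINT x|torus. (u s x \<bullet> weak_grad (\<theta> s) x) * \<phi> x) +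
                       \<kappa> * (LINT x|torus. weak_grad (\<theta> s) x \<bullet> grad \<phi> x))
        in set_integrable lborel {0..t} pairing \<and>
           (LINT x|torus. \<theta> t x * \<phi> x) - (LINT x|torus. \<theta>\<^sub>0 x * \<phi> x) = - (LBINT s:{0..t}. pairing s))"

end

theory Submission
  imports Defs
begin

text \<open>
  Write \<open>n\<close> for the dimension, \<open>\<theta>\<^sub>\<kappa>\<close> for the diffusive solution, \<open>\<theta>\<close> for the transported one and
  \<open>w = \<theta>\<^sub>\<kappa> - \<theta>\<close>, all norms without subscript being \<open>L\<^sup>2\<close> norms in space. The argument plays two facts
  against each other.

  \<^item> As long as \<open>|w| \<le> \<epsilon> = |\<theta>\<^sub>0| / (2 C n)\<close>, the diffusive solution must have a gradient comparable with
    that of the transported one. Indeed \<open>|\<nabla>\<theta>|\<^sup>2 - \<langle>\<nabla>\<theta>\<^sub>\<kappa>, \<nabla>\<theta>\<rangle> = \<langle>w, \<Delta>\<theta>\<rangle> \<le> n |w| |\<theta>|\<^sub>H\<^sub>2\<close>, and the hypothesis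
    \<open>|\<theta>|\<^sub>H\<^sub>2 \<le> C |\<nabla>\<theta>|\<^sup>2 / |\<theta>\<^sub>0|\<close> makes the right hand side at most half of \<open>|\<nabla>\<theta>|\<^sup>2\<close>, so that
    \<open>|\<nabla>\<theta>| \<le> 2 |\<nabla>\<theta>\<^sub>\<kappa>|\<close>. This is \<open>gradient_comparison\<close>.
  \<^item> Transport by a divergence free field is skew symmetric, so testing the equation of \<open>w\<close> with \<open>w\<close>
    leaves \<open>|w(t)|\<^sup>2 = 2 \<kappa> \<integral>\<^sub>0\<^sup>t \<langle>\<nabla>\<theta>\<^sub>\<kappa>, \<nabla>\<theta> - \<nabla>\<theta>\<^sub>\<kappa>\<rangle>\<close> (\<open>energy_identity\<close>). While the first fact applies, the
    integrand is at most \<open>|\<nabla>\<theta>\<^sub>\<kappa>|\<^sup>2\<close>, that is, the dissipation controls \<open>|w|\<^sup>2\<close>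
    (\<open>dissipation_bounds_distance\<close>).

  Suppose that the dissipation were at most \<open>|\<theta>\<^sub>0|\<^sup>2 / (16 C\<^sup>2 n\<^sup>2)\<close>. At the first time at which \<open>|w| = \<epsilon>\<close> the
  second fact would give \<open>\<epsilon>\<^sup>2 \<le> \<epsilon>\<^sup>2 / 2\<close>, so there is no such time. Then the first fact holds on all of
  \<open>[0, T)\<close> and \<open>|\<nabla>\<theta>\<^sub>\<kappa>(t)| \<ge> |\<nabla>\<theta>(t)| / 2 \<ge> |\<theta>\<^sub>0| / (2 C (T - t))\<close>, whose square has infinite integral up to
  \<open>T\<close>: the dissipation is infinite, a contradiction.

  The analytic work is in the energy identity, because \<open>w\<close> is not an admissible test function and the
  equation holds only weakly. It is obtained by truncating Fourier series in space. Trigonometric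
  polynomials are test functions, truncation commutes with weak derivatives, and each Fourier
  coefficient of \<open>w\<close> is an indefinite integral in time, to which the scalar identity
  \<open>square_of_antiderivative\<close> applies. Parseval's formula and dominated convergence then remove the
  truncation. Completeness of the trigonometric system and uniqueness of weak derivatives both follow
  from one approximation result, \<open>trig_approx_bounded\<close>.
\<close>

section \<open>Square integrable functions on the torus\<close>

text \<open>
  Periodicity is left out on purpose: integrals see only the fundamental domain, so it would merely be
  one more side condition to carry through every algebraic step.
\<close>

definition sq_integrable :: "((real ^ 'n) \<Rightarrow> real) \<Rightarrow> bool" where
  "sq_integrable f \<longleftrightarrow> f \<in> borel_measurable torus \<and> integrable torus (\<lambda>x. (f x)\<^sup>2)"

definition L2_inner :: "((real ^ 'n) \<Rightarrow> real) \<Rightarrow> ((real ^ 'n) \<Rightarrow> real) \<Rightarrow> real" where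
  "L2_inner f g = (LINT x|torus. f x * g x)"

lemma space_torus: "space (torus :: (real ^ 'n) measure) = cbox 0 (\<chi> i. 2 * pi)"
  by (simp add: torus_def space_restrict_space)

lemma finite_measure_torus: "finite_measure (torus :: (real ^ 'n) measure)"
  unfolding torus_def
  using emeasure_lborel_cbox_finite[of 0 "\<chi> i::'n. 2 * pi"]
  by (intro finite_measureI) (simp add: emeasure_restrict_space space_restrict_space)

lemma integrable_torus_const [simp]: "integrable (torus :: (real ^ 'n) measure) (\<lambda>x. c :: 'b::{banach,second_countable_topology})"
  using finite_measure.integrable_const[OF finite_measure_torus] .

lemma borel_measurable_torus: "f \<in> borel_measurable borel \<Longrightarrow> f \<in> borel_measurable (torus :: (real ^ 'n) measure)"
  unfolding torus_def by (rule measurable_restrict_space1) simp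

lemma L2_imp_sq_integrable: "f \<in> L2 \<Longrightarrow> sq_integrable f"
  by (simp add: L2_def sq_integrable_def)

lemma sq_integrable_measurable: "sq_integrable f \<Longrightarrow> f \<in> borel_measurable torus"
  by (simp add: sq_integrable_def)

lemma sq_integrable_mult_integrable:
  assumes "sq_integrable f" "sq_integrable g"
  shows "integrable torus (\<lambda>x. f x * g x)"
proof (rule Bochner_Integration.integrable_bound)
  show "integrable torus (\<lambda>x. (f x)\<^sup>2 + (g x)\<^sup>2)"
    using assms by (simp add: sq_integrable_def)
  show "(\<lambda>x. f x * g x) \<in> borel_measurable torus"
    using assms by (simp add: sq_integrable_def borel_measurable_times)
  have "\<bar>a * b\<bar> \<le> a\<^sup>2 + b\<^sup>2" for a b :: real
  proof -
    have "2 * \<bar>a * b\<bar> \<le> a\<^sup>2 + b\<^sup>2"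
      using sum_squares_bound[of "\<bar>a\<bar>" "\<bar>b\<bar>"] by (simp add: abs_mult)
    then show ?thesis using abs_ge_zero[of "a * b"] by linarith
  qed
  then show "AE x in torus. norm (f x * g x) \<le> norm ((f x)\<^sup>2 + (g x)\<^sup>2)"
    by (intro AE_I2) (metis abs_ge_self order_trans real_norm_def)
qed

lemma sq_integrable_add:
  assumes "sq_integrable f" "sq_integrable g"
  shows "sq_integrable (\<lambda>x. f x + g x)"
  using assms sq_integrable_mult_integrable[OF assms]
  by (auto simp: sq_integrable_def power2_sum mult.assoc)

lemma sq_integrable_cmult: "sq_integrable f \<Longrightarrow> sq_integrable (\<lambda>x. c * f x)"
  by (auto simp: sq_integrable_def power_mult_distrib)

lemma sq_integrable_diff:
  assumes "sq_integrable f" "sq_integrable g"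
  shows "sq_integrable (\<lambda>x. f x - g x)"
  using sq_integrable_add[OF assms(1) sq_integrable_cmult[OF assms(2), of "-1"]] by simp

lemma sq_integrable_bounded:
  assumes "f \<in> borel_measurable torus" "AE x in torus. \<bar>f x\<bar> \<le> B"
  shows "sq_integrable f"
  unfolding sq_integrable_def
proof
  show "integrable torus (\<lambda>x. (f x)\<^sup>2)"
  proof (rule Bochner_Integration.integrable_bound)
    show "integrable torus (\<lambda>x::real^'a. B\<^sup>2)" by simp
    show "(\<lambda>x. (f x)\<^sup>2) \<in> borel_measurable torus" using assms by measurable
    show "AE x in torus. norm ((f x)\<^sup>2) \<le> norm (B\<^sup>2)"
      using assms(2) by eventually_elim (simp add: abs_le_square_iff[symmetric])
  qed
qed fact

lemma sq_integrable_const: "sq_integrable (\<lambda>x. c)"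
  by (rule sq_integrable_bounded[where B = "\<bar>c\<bar>"]) auto

lemma sq_integrable_sum:
  "(\<And>i. i \<in> I \<Longrightarrow> sq_integrable (f i)) \<Longrightarrow> sq_integrable (\<lambda>x. \<Sum>i\<in>I. f i x)"
  by (induction I rule: infinite_finite_induct) (auto intro: sq_integrable_add sq_integrable_const)

lemma sq_integrable_integrable: "sq_integrable f \<Longrightarrow> integrable torus f"
  using sq_integrable_mult_integrable[of f "\<lambda>x. 1"] by (simp add: sq_integrable_const)

lemma sq_integrable_continuous:
  assumes "continuous_on UNIV f"
  shows "sq_integrable f"
proof -
  have "compact (f ` cbox 0 (\<chi> i. 2 * pi))"
    using assms by (intro compact_continuous_image compact_cbox) (auto intro: continuous_on_subset)
  then obtain B where B: "\<And>x. x \<in> cbox 0 (\<chi> i. 2 * pi) \<Longrightarrow> \<bar>f x\<bar> \<le> B"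
    using compact_imp_bounded by (force simp: bounded_iff)
  show ?thesis
    by (rule sq_integrable_bounded[where B = B])
       (auto simp: space_torus intro!: borel_measurable_torus borel_measurable_continuous_onI assms AE_I2 B)
qed

lemma sq_integrable_bounded_mult:
  assumes "b \<in> borel_measurable torus" "AE x in torus. \<bar>b x\<bar> \<le> B" "sq_integrable f"
  shows "sq_integrable (\<lambda>x. b x * f x)"
  unfolding sq_integrable_def
proof
  show m: "(\<lambda>x. b x * f x) \<in> borel_measurable torus"
    using assms by (auto simp: sq_integrable_def)
  show "integrable torus (\<lambda>x. (b x * f x)\<^sup>2)"
  proof (rule Bochner_Integration.integrable_bound)
    show "integrable torus (\<lambda>x. B\<^sup>2 * (f x)\<^sup>2)" using assms by (simp add: sq_integrable_def)
    show "(\<lambda>x. (b x * f x)\<^sup>2) \<in> borel_measurable torus" using m by measurable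
    show "AE x in torus. norm ((b x * f x)\<^sup>2) \<le> norm (B\<^sup>2 * (f x)\<^sup>2)"
      using assms(2)
    proof eventually_elim
      case (elim x)
      then have "(b x)\<^sup>2 \<le> B\<^sup>2" by (simp add: abs_le_square_iff[symmetric])
      then show ?case by (simp add: power_mult_distrib mult_right_mono)
    qed
  qed
qed

lemma L2_inner_commute: "L2_inner f g = L2_inner g f"
  by (simp add: L2_inner_def mult.commute)

lemma L2_inner_add_left:
  "sq_integrable f \<Longrightarrow> sq_integrable g \<Longrightarrow> sq_integrable h \<Longrightarrow> L2_inner (\<lambda>x. f x + g x) h = L2_inner f h + L2_inner g h"
  by (simp add: L2_inner_def distrib_right sq_integrable_mult_integrable)

lemma L2_inner_diff_left:
  "sq_integrable f \<Longrightarrow> sq_integrable g \<Longrightarrow> sq_integrable h \<Longrightarrow> L2_inner (\<lambda>x. f x - g x) h = L2_inner f h - L2_inner g h"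
  by (simp add: L2_inner_def left_diff_distrib sq_integrable_mult_integrable)

lemma L2_inner_cmult_left: "L2_inner (\<lambda>x. c * f x) h = c * L2_inner f h"
  by (simp add: L2_inner_def mult.assoc)

lemma L2_inner_add_right:
  "sq_integrable f \<Longrightarrow> sq_integrable g \<Longrightarrow> sq_integrable h \<Longrightarrow> L2_inner h (\<lambda>x. f x + g x) = L2_inner h f + L2_inner h g"
  by (simp add: L2_inner_commute[of h] L2_inner_add_left)

lemma L2_inner_diff_right:
  "sq_integrable f \<Longrightarrow> sq_integrable g \<Longrightarrow> sq_integrable h \<Longrightarrow> L2_inner h (\<lambda>x. f x - g x) = L2_inner h f - L2_inner h g"
  by (simp add: L2_inner_commute[of h] L2_inner_diff_left)

lemma L2_inner_cmult_right: "L2_inner h (\<lambda>x. c * f x) = c * L2_inner h f"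
  by (simp add: L2_inner_commute[of h] L2_inner_cmult_left)

lemma L2_inner_sum_left:
  assumes "\<And>i. i \<in> I \<Longrightarrow> sq_integrable (f i)" "sq_integrable h"
  shows "L2_inner (\<lambda>x. \<Sum>i\<in>I. f i x) h = (\<Sum>i\<in>I. L2_inner (f i) h)"
  using assms
proof (induction I rule: infinite_finite_induct)
  case (insert a I)
  then show ?case by (simp add: L2_inner_add_left sq_integrable_sum)
qed (auto simp: L2_inner_def)

lemma L2_inner_self_nonneg: "L2_inner f f \<ge> 0"
  by (simp add: L2_inner_def)

lemma L2_norm_power2: "(L2_norm f)\<^sup>2 = L2_inner f f"
  using L2_inner_self_nonneg[of f] by (simp add: L2_norm_def L2_inner_def power2_eq_square[symmetric])

lemma L2_norm_nonneg: "L2_norm f \<ge> 0"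
  by (simp add: L2_norm_def)

lemma L2_norm_zero: "L2_norm (\<lambda>x. 0) = 0"
  by (simp add: L2_norm_def)

lemma L2_norm_commute: "L2_norm (\<lambda>x. f x - g x) = L2_norm (\<lambda>x. g x - f x)"
  by (simp add: L2_norm_def power2_commute)

lemma Cauchy_Schwarz_L2:
  assumes "sq_integrable f" "sq_integrable g"
  shows "\<bar>L2_inner f g\<bar> \<le> L2_norm f * L2_norm g"
proof -
  have q: "0 \<le> L2_inner f f - 2 * t * L2_inner f g + t\<^sup>2 * L2_inner g g" for t
  proof -
    have "0 \<le> L2_inner (\<lambda>x. f x - t * g x) (\<lambda>x. f x - t * g x)" by (rule L2_inner_self_nonneg)
    also have "\<dots> = L2_inner f f - 2 * t * L2_inner f g + t\<^sup>2 * L2_inner g g"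
      using assms
      by (simp add: L2_inner_diff_left L2_inner_diff_right sq_integrable_diff sq_integrable_cmult L2_inner_cmult_left
          L2_inner_cmult_right L2_inner_commute[of g f] algebra_simps power2_eq_square)
    finally show ?thesis .
  qed
  have "(L2_inner f g)\<^sup>2 \<le> L2_inner f f * L2_inner g g"
  proof (cases "L2_inner g g = 0")
    case True
    have "L2_inner f g = 0"
    proof (rule ccontr)
      assume "L2_inner f g \<noteq> 0"
      with q[of "(L2_inner f f + 1) / (2 * L2_inner f g)"] True show False by (simp add: field_simps)
    qed
    with True show ?thesis by simp
  next
    case False
    with L2_inner_self_nonneg[of g] have "L2_inner g g > 0" by linarith
    with q[of "L2_inner f g / L2_inner g g"] show ?thesis by (simp add: field_simps power2_eq_square)
  qed
  then have "\<bar>L2_inner f g\<bar> \<le> sqrt (L2_inner f f * L2_inner g g)"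
    using real_le_rsqrt by (metis power2_abs)
  also have "\<dots> = L2_norm f * L2_norm g"
    by (simp add: real_sqrt_mult L2_norm_def L2_inner_def power2_eq_square)
  finally show ?thesis .
qed

lemma L2_norm_triangle:
  assumes "sq_integrable f" "sq_integrable g"
  shows "L2_norm (\<lambda>x. f x + g x) \<le> L2_norm f + L2_norm g"
proof (rule power2_le_imp_le)
  have "(L2_norm (\<lambda>x. f x + g x))\<^sup>2 = L2_inner f f + 2 * L2_inner f g + L2_inner g g"
    using assms by (simp add: L2_norm_power2 L2_inner_add_left L2_inner_add_right sq_integrable_add L2_inner_commute[of g f])
  also have "\<dots> \<le> (L2_norm f + L2_norm g)\<^sup>2"
    using Cauchy_Schwarz_L2[OF assms] by (simp add: power2_sum L2_norm_power2)
  finally show "(L2_norm (\<lambda>x. f x + g x))\<^sup>2 \<le> (L2_norm f + L2_norm g)\<^sup>2" .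
qed (simp add: L2_norm_nonneg)

lemma L2_norm_cmult: "L2_norm (\<lambda>x. c * f x) = \<bar>c\<bar> * L2_norm f"
  by (simp add: L2_norm_def power_mult_distrib real_sqrt_mult)

lemma L2_norm_triangle_diff:
  assumes "sq_integrable f" "sq_integrable g"
  shows "L2_norm (\<lambda>x. f x - g x) \<le> L2_norm f + L2_norm g"
  using L2_norm_triangle[OF assms(1) sq_integrable_cmult[OF assms(2), of "-1"]] L2_norm_cmult[of "-1" g]
  by simp

lemma L2_norm_cong_AE:
  assumes "AE x in torus. f x = g x" "f \<in> borel_measurable torus" "g \<in> borel_measurable torus"
  shows "L2_norm f = L2_norm g"
  unfolding L2_norm_def
  by (intro arg_cong[where f = sqrt] integral_cong_AE) (use assms in \<open>auto elim: AE_mp\<close>)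

lemma L2_inner_tendsto:
  assumes "\<And>n. sq_integrable (f n)" "\<And>n. sq_integrable (g n)" "sq_integrable F" "sq_integrable G"
    and f: "(\<lambda>n. L2_norm (\<lambda>x. f n x - F x)) \<longlonglongrightarrow> 0"
    and g: "(\<lambda>n. L2_norm (\<lambda>x. g n x - G x)) \<longlonglongrightarrow> 0"
  shows "(\<lambda>n. L2_inner (f n) (g n)) \<longlonglongrightarrow> L2_inner F G"
proof -
  have "(\<lambda>n. L2_norm (\<lambda>x. f n x - F x) * L2_norm (\<lambda>x. g n x - G x)
      + L2_norm (\<lambda>x. f n x - F x) * L2_norm G + L2_norm F * L2_norm (\<lambda>x. g n x - G x)) \<longlonglongrightarrow> 0 * 0 + 0 * L2_norm G + L2_norm F * 0"
    by (intro tendsto_intros f g)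
  moreover have "\<bar>L2_inner (f n) (g n) - L2_inner F G\<bar> \<le> L2_norm (\<lambda>x. f n x - F x) * L2_norm (\<lambda>x. g n x - G x)
      + L2_norm (\<lambda>x. f n x - F x) * L2_norm G + L2_norm F * L2_norm (\<lambda>x. g n x - G x)" for n
  proof -
    have "L2_inner (f n) (g n) - L2_inner F G = L2_inner (\<lambda>x. f n x - F x) (\<lambda>x. g n x - G x)
        + L2_inner (\<lambda>x. f n x - F x) G + L2_inner F (\<lambda>x. g n x - G x)"
      using assms(1-4) by (simp add: L2_inner_diff_left L2_inner_diff_right sq_integrable_diff)
    then show ?thesis
      using Cauchy_Schwarz_L2[of "\<lambda>x. f n x - F x" "\<lambda>x. g n x - G x"]
        Cauchy_Schwarz_L2[of "\<lambda>x. f n x - F x" G] Cauchy_Schwarz_L2[of F "\<lambda>x. g n x - G x"] assms(1-4)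
      by (simp add: sq_integrable_diff)
  qed
  ultimately have "(\<lambda>n. L2_inner (f n) (g n) - L2_inner F G) \<longlonglongrightarrow> 0"
    by (auto intro: Lim_null_comparison[where g = "\<lambda>n. L2_norm (\<lambda>x. f n x - F x) * L2_norm (\<lambda>x. g n x - G x)
      + L2_norm (\<lambda>x. f n x - F x) * L2_norm G + L2_norm F * L2_norm (\<lambda>x. g n x - G x)"])
  then show ?thesis by (simp add: LIM_zero_iff)
qed

section \<open>Trigonometric polynomials\<close>

definition phase :: "int ^ 'n \<Rightarrow> real ^ 'n \<Rightarrow> real" where
  "phase k x = (\<Sum>i\<in>UNIV. of_int (k $ i) * x $ i)"

text \<open>
  Real trigonometric polynomials. They are generated inductively, without coefficients, so that
  statements about them reduce by induction to the two generators.
\<close>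

inductive_set trig :: "((real ^ 'n) \<Rightarrow> real) set" where
  trig_cos: "(\<lambda>x. cos (phase k x)) \<in> trig"
| trig_sin: "(\<lambda>x. sin (phase k x)) \<in> trig"
| trig_add: "p \<in> trig \<Longrightarrow> q \<in> trig \<Longrightarrow> (\<lambda>x. p x + q x) \<in> trig"
| trig_cmult: "p \<in> trig \<Longrightarrow> (\<lambda>x. c * p x) \<in> trig"

lemma phase_add: "phase (k + l) x = phase k x + phase l x"
  by (simp add: phase_def distrib_right sum.distrib)

lemma phase_diff: "phase (k - l) x = phase k x - phase l x"
  by (simp add: phase_def left_diff_distrib sum_subtractf)

lemma phase_uminus: "phase (- k) x = - phase k x"
  by (simp add: phase_def sum_negf)

lemma phase_zero: "phase 0 x = 0"
  by (simp add: phase_def)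

lemma phase_axis: "phase k (axis i h) = of_int (k $ i) * h"
  by (simp add: phase_def axis_def if_distrib cong: if_cong)

lemma phase_unit: "phase (axis i 1) x = x $ i"
proof -
  have "phase (axis i 1) x = (\<Sum>j\<in>UNIV. if j = i then x $ j else 0)"
    unfolding phase_def by (rule sum.cong) (auto simp: axis_def)
  then show ?thesis by simp
qed

lemma linear_phase: "bounded_linear (phase k)"
  unfolding phase_def[abs_def]
  by (intro bounded_linear_sum bounded_linear_const_mult bounded_linear_vec_nth)

lemma phase_add_right: "phase k (x + y) = phase k x + phase k y"
  by (rule linear_add[OF bounded_linear.linear[OF linear_phase]])

lemma trig_const: "(\<lambda>x. c) \<in> trig"
  using trig_cmult[OF trig_cos[of 0], of c] by (simp add: phase_zero)

lemma trig_diff: "p \<in> trig \<Longrightarrow> q \<in> trig \<Longrightarrow> (\<lambda>x. p x - q x) \<in> trig"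
  using trig_add[OF _ trig_cmult[of q "-1"], of p] by simp

lemma trig_sum: "(\<And>i. i \<in> I \<Longrightarrow> p i \<in> trig) \<Longrightarrow> (\<lambda>x. \<Sum>i\<in>I. p i x) \<in> trig"
  by (induction I rule: infinite_finite_induct) (auto intro: trig_add trig_const)

lemma trig_mult_basis:
  "(\<lambda>x. cos (phase k x) * cos (phase l x)) \<in> trig"
  "(\<lambda>x. sin (phase k x) * sin (phase l x)) \<in> trig"
  "(\<lambda>x. sin (phase k x) * cos (phase l x)) \<in> trig"
  "(\<lambda>x. cos (phase k x) * sin (phase l x)) \<in> trig"
proof -
  have "(\<lambda>x. (1/2) * (cos (phase (k - l) x) + cos (phase (k + l) x))) \<in> trig"
    by (intro trig.intros)
  then show "(\<lambda>x. cos (phase k x) * cos (phase l x)) \<in> trig"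
    by (simp add: phase_add phase_diff cos_times_cos add.commute)
  have "(\<lambda>x. (1/2) * (cos (phase (k - l) x) - cos (phase (k + l) x))) \<in> trig"
    by (intro trig.intros trig_diff)
  then show "(\<lambda>x. sin (phase k x) * sin (phase l x)) \<in> trig"
    by (simp add: phase_add phase_diff sin_times_sin)
  have *: "(\<lambda>x. sin (phase k x) * cos (phase l x)) \<in> trig" for k l :: "int^'a"
  proof -
    have "(\<lambda>x. (1/2) * (sin (phase (k + l) x) + sin (phase (k - l) x))) \<in> trig"
      by (intro trig.intros)
    then show ?thesis
      by (simp add: phase_add phase_diff sin_times_cos)
  qed
  show "(\<lambda>x. sin (phase k x) * cos (phase l x)) \<in> trig" by (rule *)
  show "(\<lambda>x. cos (phase k x) * sin (phase l x)) \<in> trig"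
    using *[of l k] by (simp add: mult.commute)
qed

lemma trig_mult:
  assumes "p \<in> trig" "q \<in> trig"
  shows "(\<lambda>x. p x * q x) \<in> trig"
  using assms(1)
proof induction
  case (trig_cos k)
  show ?case using assms(2)
    by induction (auto simp: distrib_left mult.left_commute intro: trig_mult_basis trig.intros)
next
  case (trig_sin k)
  show ?case using assms(2)
    by induction (auto simp: distrib_left mult.left_commute intro: trig_mult_basis trig.intros)
next
  case (trig_add p q)
  then show ?case by (auto simp: distrib_right intro: trig.trig_add)
next
  case (trig_cmult p c)
  then show ?case by (auto simp: mult.assoc intro: trig.trig_cmult)
qed

lemma has_derivative_phase: "(phase k has_derivative phase k) (at x)"
  by (rule bounded_linear_imp_has_derivative[OF linear_phase])

lemma has_derivative_cos_phase:
  "((\<lambda>x. cos (phase k x)) has_derivative (\<lambda>h. - sin (phase k x) * phase k h)) (at x)"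
  by (rule has_derivative_eq_rhs, rule has_derivative_cos, rule has_derivative_phase) (auto simp: fun_eq_iff)

lemma has_derivative_sin_phase:
  "((\<lambda>x. sin (phase k x)) has_derivative (\<lambda>h. cos (phase k x) * phase k h)) (at x)"
  by (rule has_derivative_eq_rhs, rule has_derivative_sin, rule has_derivative_phase) (auto simp: fun_eq_iff)

lemma grad_eqI: "(f has_derivative f') (at x) \<Longrightarrow> grad f x $ i = f' (axis i 1)"
  by (simp add: grad_def frechet_derivative_at[symmetric])

lemma grad_cos: "grad (\<lambda>x. cos (phase k x)) x $ i = - of_int (k $ i) * sin (phase k x)"
  by (simp add: grad_eqI[OF has_derivative_cos_phase] phase_axis)

lemma grad_sin: "grad (\<lambda>x. sin (phase k x)) x $ i = of_int (k $ i) * cos (phase k x)"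
  by (simp add: grad_eqI[OF has_derivative_sin_phase] phase_axis)

lemma grad_add:
  assumes "f differentiable (at x)" "g differentiable (at x)"
  shows "grad (\<lambda>x. f x + g x) x $ i = grad f x $ i + grad g x $ i"
  using grad_eqI[OF has_derivative_add[OF assms[unfolded frechet_derivative_works]], of i]
  by (simp add: grad_def)

lemma grad_cmult:
  assumes "f differentiable (at x)"
  shows "grad (\<lambda>x. c * f x) x $ i = c * grad f x $ i"
  using grad_eqI[OF has_derivative_mult_right[OF assms[unfolded frechet_derivative_works]], of c i]
  by (simp add: grad_def)

lemma grad_mult:
  assumes "f differentiable (at x)" "g differentiable (at x)"
  shows "grad (\<lambda>x. f x * g x) x $ i = f x * grad g x $ i + grad f x $ i * g x"
  using grad_eqI[OF has_derivative_mult[OF assms[unfolded frechet_derivative_works]], of i]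
  by (simp add: grad_def)

lemma trig_differentiable: "p \<in> trig \<Longrightarrow> p differentiable (at x)"
  by (induction rule: trig.induct)
     (auto intro!: differentiableI has_derivative_cos_phase has_derivative_sin_phase)

lemma trig_grad: "p \<in> trig \<Longrightarrow> (\<lambda>x. grad p x $ i) \<in> trig"
proof (induction rule: trig.induct)
  case (trig_cos k)
  show ?case unfolding grad_cos by (intro trig.intros)
next
  case (trig_sin k)
  show ?case unfolding grad_sin by (intro trig.intros)
next
  case (trig_add p q)
  then show ?case by (simp add: grad_add trig_differentiable trig.trig_add)
next
  case (trig_cmult p c)
  then show ?case by (simp add: grad_cmult trig_differentiable trig.trig_cmult)
qed

lemma trig_continuous: "p \<in> trig \<Longrightarrow> continuous_on S p"
  by (meson continuous_at_imp_continuous_on differentiable_imp_continuous_within trig_differentiable)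

lemma cos_sin_int_2pi: "cos (of_int m * (2 * pi)) = 1" "sin (of_int m * (2 * pi)) = 0"
  using cos_int_2pin[of m] sin_int_2pin[of m] by (simp_all add: mult_ac)

lemma trig_periodic: "p \<in> trig \<Longrightarrow> periodic p"
proof (induction rule: trig.induct)
  case (trig_cos k)
  show ?case
    by (simp add: periodic_def phase_add_right phase_axis cos_add cos_sin_int_2pi)
next
  case (trig_sin k)
  show ?case
    by (simp add: periodic_def phase_add_right phase_axis sin_add cos_sin_int_2pi)
qed (auto simp: periodic_def)

text \<open>
  The weak identities below are exploited only through these test functions.
\<close>

lemma trig_test_function:
  assumes "p \<in> trig" shows "p \<in> test_functions"
proof -
  have "continuously_differentiable k p" for k
    using assms
    by (induction k arbitrary: p) (auto intro: trig_continuous trig_differentiable trig_grad)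
  then show ?thesis using trig_periodic[OF assms] by (simp add: test_functions_def)
qed

lemma sq_integrable_trig: "p \<in> trig \<Longrightarrow> sq_integrable p"
  by (intro sq_integrable_continuous trig_continuous)

section \<open>Density of trigonometric polynomials\<close>

text \<open>
  One of the two angles is interior because \<open>0\<close> and \<open>2\<pi>\<close> have the same image.
\<close>

lemma cis_inj_period:
  assumes "cis a = cis b" "0 < a" "a < 2 * pi" "0 \<le> b" "b \<le> 2 * pi"
  shows "a = b"
proof -
  have "sin a = sin b \<and> cos a = cos b" using assms(1) by (simp add: complex_eq_iff)
  then obtain m :: int where m: "a = b + 2 * pi * m"
    using sin_cos_eq_iff[of a b] by auto
  have "-1 < real_of_int m \<and> real_of_int m < 1"
  proof -
    have "2 * pi * real_of_int m < 2 * pi * 1" "2 * pi * (-1) < 2 * pi * real_of_int m"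
      using m assms by linarith+
    then have "real_of_int m < 1" "-1 < real_of_int m"
      by (simp_all only: mult_less_cancel_left_pos[of "2 * pi"] pi_gt_zero zero_less_mult_iff zero_less_numeral simp_thms)
    then show ?thesis by simp
  qed
  then have "m = 0" by linarith
  with m show ?thesis by simp
qed

text \<open>
  Stone--Weierstrass on the image of the cube under \<open>x \<mapsto> (cis x\<^sub>i)\<^sub>i\<close>. On the cube itself trigonometric
  polynomials do not separate opposite faces, but on this image they separate points, and \<open>h\<close>
  descends to it because the points that are glued together lie on the boundary, where \<open>h\<close> vanishes.
\<close>

lemma trig_approx_continuous:
  fixes h :: "real ^ 'n \<Rightarrow> real"
  defines "Q \<equiv> cbox 0 (\<chi> i. 2 * pi)"
  assumes h: "continuous_on Q h" and zero: "\<And>x. x \<in> Q \<Longrightarrow> x \<notin> box 0 (\<chi> i. 2 * pi) \<Longrightarrow> h x = 0"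
    and e: "e > 0"
  obtains p where "p \<in> trig" "\<And>x. x \<in> Q \<Longrightarrow> \<bar>h x - p x\<bar> < e"
proof -
  define E :: "real ^ 'n \<Rightarrow> complex ^ 'n" where "E x = (\<chi> i. cis (x $ i))" for x
  define K where "K = E ` Q"
  define H where "H z = h (SOME x. x \<in> Q \<and> E x = z)" for z
  have contE: "continuous_on S E" for S
    unfolding E_def[abs_def]
    by (intro continuous_on_vec_lambda continuous_intros)
  have cQ: "compact Q" by (simp add: Q_def compact_cbox)
  have inj: "x = y" if "E x = E y" "x \<in> box 0 (\<chi> i. 2 * pi)" "y \<in> Q" for x y
    using that cis_inj_period by (auto simp: vec_eq_iff E_def Q_def mem_box_cart)
  have same: "h x = h y" if "E x = E y" "x \<in> Q" "y \<in> Q" for x y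
  proof (cases "x = y")
    case False
    have "x \<notin> box 0 (\<chi> i. 2 * pi)"
    proof
      assume "x \<in> box 0 (\<chi> i. 2 * pi)"
      from inj[OF that(1) this that(3)] False show False by simp
    qed
    moreover have "y \<notin> box 0 (\<chi> i. 2 * pi)"
    proof
      assume "y \<in> box 0 (\<chi> i. 2 * pi)"
      from inj[OF that(1)[symmetric] this that(2)] False show False by simp
    qed
    ultimately show ?thesis using zero[OF that(2)] zero[OF that(3)] by simp
  qed simp
  have HE: "H (E x) = h x" if "x \<in> Q" for x
    unfolding H_def
  proof (rule someI2[of _ x])
    show "h z = h x" if "z \<in> Q \<and> E z = E x" for z
      using same[of z x] that \<open>x \<in> Q\<close> by blast
  qed (use that in simp)
  have cK: "compact K" unfolding K_def by (intro compact_continuous_image contE cQ)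
  have "closed (H -` B \<inter> K)" if B: "closed B" for B
  proof -
    have "H -` B \<inter> K = E ` (h -` B \<inter> Q)" using HE by (auto simp: K_def)
    moreover have "closed (h -` B \<inter> Q)"
      using h B cQ by (simp add: continuous_on_closed_vimage compact_imp_closed)
    then have "compact (Q \<inter> (h -` B \<inter> Q))"
      using cQ by (rule compact_Int_closed[rotated])
    then have "compact (h -` B \<inter> Q)" by (simp add: inf_commute inf_left_commute)
    ultimately show ?thesis
      by (simp add: compact_continuous_image compact_imp_closed contE)
  qed
  then have contH: "continuous_on K H"
    using cK by (simp add: continuous_on_closed_vimage compact_imp_closed)
  define P where "P q \<longleftrightarrow> continuous_on K q \<and> (\<lambda>x. q (E x)) \<in> trig" for q :: "complex ^ 'n \<Rightarrow> real"
  have "\<exists>g. P g \<and> (\<forall>z\<in>K. \<bar>H z - g z\<bar> < e)"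
  proof (rule Stone_Weierstrass_HOL[where P = P])
    fix z w assume zw: "z \<in> K \<and> w \<in> K \<and> z \<noteq> w"
    then obtain i where "z $ i \<noteq> w $ i" by (auto simp: vec_eq_iff)
    then have "Re (z $ i) \<noteq> Re (w $ i) \<or> Im (z $ i) \<noteq> Im (w $ i)" by (auto simp: complex_eq_iff)
    moreover have "P (\<lambda>z. Re (z $ i))" "P (\<lambda>z. Im (z $ i))"
      using trig_cos[of "axis i 1"] trig_sin[of "axis i 1"]
      by (auto simp: P_def E_def phase_unit intro!: continuous_intros)
    ultimately show "\<exists>f. P f \<and> f z \<noteq> f w" by blast
  qed (use cK contH e in \<open>auto simp: P_def intro: trig_const trig_add trig_mult continuous_intros\<close>)
  then obtain g where g: "P g" "\<And>z. z \<in> K \<Longrightarrow> \<bar>H z - g z\<bar> < e" by blast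
  show thesis
  proof
    show "(\<lambda>x. g (E x)) \<in> trig" using g by (simp add: P_def)
    show "\<bar>h x - g (E x)\<bar> < e" if "x \<in> Q" for x
      using g(2)[of "E x"] that HE by (simp add: K_def)
  qed
qed

lemma AE_torus_iff:
  "(AE x in torus. P x) \<longleftrightarrow> (AE x in lborel. x \<in> cbox 0 (\<chi> i. 2 * pi) \<longrightarrow> P x)"
  unfolding torus_def by (rule AE_restrict_space_iff) simp

text \<open>
  A measurable function is almost everywhere the limit of continuous functions. Clipping these keeps
  them bounded by \<open>B\<close>, and a cutoff that tends to \<open>1\<close> on the open cube makes them vanish on the
  boundary, so that they can be replaced by trigonometric polynomials up to an error \<open>1 / (n + 1)\<close>.
  Bounded pointwise convergence is the form in which dominated convergence can be applied both to
  \<open>L\<^sup>1\<close> (uniqueness) and to \<open>L\<^sup>2\<close> (density).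
\<close>

lemma trig_approx_bounded:
  fixes f :: "real ^ 'n \<Rightarrow> real"
  assumes f: "f \<in> borel_measurable torus" and B: "\<And>x. \<bar>f x\<bar> \<le> B"
  obtains p where "\<And>n::nat. p n \<in> trig" "\<And>n x. x \<in> space torus \<Longrightarrow> \<bar>p n x\<bar> \<le> B + 1"
    "AE x in torus. (\<lambda>n. p n x) \<longlonglongrightarrow> f x"
proof -
  define Q :: "(real ^ 'n) set" where "Q = cbox 0 (\<chi> i. 2 * pi)"
  define U :: "(real ^ 'n) set" where "U = box 0 (\<chi> i. 2 * pi)"
  have B0: "B \<ge> 0" using B[of 0] by linarith
  have "f \<in> borel_measurable (lebesgue_on Q)"
    using f unfolding torus_def Q_def
    by (simp add: borel_measurable_restrict_space_iff measurable_completion)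
  then have "f measurable_on Q"
    by (simp add: measurable_on_iff_borel_measurable Q_def)
  then obtain N g where N: "negligible N" and g: "\<And>n::nat. continuous_on UNIV (g n)"
    and lim: "\<And>x. x \<notin> N \<Longrightarrow> (\<lambda>n. g n x) \<longlonglongrightarrow> (if x \<in> Q then f x else (0::real))"
    unfolding measurable_on_def by blast
  define c where "c n x = min 1 (real n * infdist x (- U))" for n x
  define h where "h n x = c n x * max (- B) (min B (g n x))" for n x
  have U0: "- U \<noteq> {}"
  proof -
    have "(0::real^'n) \<notin> U" by (auto simp: U_def mem_box_cart)
    then show ?thesis by blast
  qed
  have contc: "continuous_on UNIV (c n)" for n
    unfolding c_def by (intro continuous_intros)
  have conth: "continuous_on S (h n)" for n S
    unfolding h_def
    by (intro continuous_intros continuous_on_subset[OF g] continuous_on_subset[OF contc]) auto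
  have c01: "0 \<le> c n x" "c n x \<le> 1" for n x
    by (auto simp: c_def infdist_nonneg)
  have hB: "\<bar>h n x\<bar> \<le> B" for n x
  proof -
    have "\<bar>h n x\<bar> = c n x * \<bar>max (- B) (min B (g n x))\<bar>" by (simp add: h_def abs_mult c01)
    also have "\<dots> \<le> 1 * B" using c01 B0 by (intro mult_mono) auto
    finally show ?thesis by simp
  qed
  have h0: "h n x = 0" if "x \<notin> U" for n x
    using that by (simp add: h_def c_def)
  have "\<exists>p. p \<in> trig \<and> (\<forall>x\<in>Q. \<bar>h n x - p x\<bar> < 1 / (1 + real n))" for n
  proof -
    have "1 / (1 + real n) > 0" by simp
    then obtain p where "p \<in> trig" "\<And>x. x \<in> Q \<Longrightarrow> \<bar>h n x - p x\<bar> < 1 / (1 + real n)"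
      unfolding Q_def
      by (rule trig_approx_continuous[OF conth[of _ n], rotated]) (auto simp: U_def[symmetric] h0)
    then show ?thesis by blast
  qed
  then obtain p where p: "\<And>n. p n \<in> trig" "\<And>n x. x \<in> Q \<Longrightarrow> \<bar>h n x - p n x\<bar> < 1 / (1 + real n)"
    by metis
  have pB: "\<bar>p n x\<bar> \<le> B + 1" if "x \<in> Q" for n x
  proof -
    have "1 / (1 + real n) \<le> 1" by simp
    then show ?thesis using p(2)[OF that, of n] hB[of n x] by linarith
  qed
  have limp: "(\<lambda>n. p n x) \<longlonglongrightarrow> f x" if x: "x \<in> U" "x \<notin> N" for x
  proof -
    have xQ: "x \<in> Q" using x by (auto simp: Q_def U_def mem_box_cart less_imp_le)
    have d: "infdist x (- U) > 0"
      using infdist_pos_not_in_closed[of "- U" x] U0 x by (simp add: U_def closed_Compl open_box)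
    have "c n x = 1" if "n \<ge> nat \<lceil>1 / infdist x (- U)\<rceil>" for n
    proof -
      have "1 / infdist x (- U) \<le> real n" using that by linarith
      then show ?thesis using d by (simp add: c_def field_simps)
    qed
    then have "eventually (\<lambda>n. c n x = 1) sequentially"
      unfolding eventually_sequentially by blast
    then have c1: "(\<lambda>n. c n x) \<longlonglongrightarrow> 1" by (rule tendsto_eventually)
    have "(\<lambda>n. g n x) \<longlonglongrightarrow> f x" using lim[OF x(2)] xQ by simp
    then have "(\<lambda>n. h n x) \<longlonglongrightarrow> 1 * max (- B) (min B (f x))"
      unfolding h_def by (intro tendsto_intros c1)
    moreover have "max (- B) (min B (f x)) = f x" using B[of x] by linarith
    ultimately have hl: "(\<lambda>n. h n x) \<longlonglongrightarrow> f x" by simp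
    have "(\<lambda>n. h n x - p n x) \<longlonglongrightarrow> 0"
    proof (rule Lim_null_comparison)
      show "eventually (\<lambda>n. norm (h n x - p n x) \<le> 1 / (1 + real n)) sequentially"
        using p(2)[OF xQ] by (auto intro!: always_eventually less_imp_le)
      show "(\<lambda>n. 1 / (1 + real n)) \<longlonglongrightarrow> 0"
        using LIMSEQ_inverse_real_of_nat by (simp add: inverse_eq_divide add.commute)
    qed
    from tendsto_diff[OF hl this] show ?thesis by simp
  qed
  have "negligible (N \<union> (Q - U))"
    using N unfolding Q_def U_def by (intro negligible_Un negligible_frontier_interval)
  then have "AE x in lebesgue. x \<notin> N \<union> (Q - U)"
    unfolding negligible_iff_null_sets by (rule AE_not_in)
  then have "AE x in lborel. x \<notin> N \<union> (Q - U)" by (simp add: AE_completion_iff)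
  then have "AE x in torus. (\<lambda>n. p n x) \<longlonglongrightarrow> f x"
    unfolding AE_torus_iff Q_def[symmetric] by eventually_elim (use limp in auto)
  then show thesis
    by (intro that[of p]) (use p(1) pB in \<open>auto simp: space_torus Q_def\<close>)
qed

text \<open>
  Approximating \<open>sgn f\<close> by trigonometric polynomials shows \<open>\<integral>|f| = \<integral> f sgn f = 0\<close>.
\<close>

lemma trig_orthogonal_imp_AE_zero:
  assumes f: "integrable torus f" and orth: "\<And>p. p \<in> trig \<Longrightarrow> (LINT x|torus. f x * p x) = 0"
  shows "AE x in torus. f x = 0"
proof -
  have m: "f \<in> borel_measurable torus" using f by auto
  have "(\<lambda>x. sgn (f x)) \<in> borel_measurable torus" using m by measurable
  moreover have "\<bar>sgn (f x)\<bar> \<le> 1" for x by (simp add: sgn_if)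
  ultimately obtain p where p: "\<And>n::nat. p n \<in> trig" and pb: "\<And>n x. x \<in> space torus \<Longrightarrow> \<bar>p n x\<bar> \<le> 1 + 1"
    and lim: "AE x in torus. (\<lambda>n. p n x) \<longlonglongrightarrow> sgn (f x)"
    using trig_approx_bounded[of "\<lambda>x. sgn (f x)" 1] by blast
  have "(\<lambda>n. LINT x|torus. f x * p n x) \<longlonglongrightarrow> (LINT x|torus. f x * sgn (f x))"
  proof (rule integral_dominated_convergence[where w = "\<lambda>x. 2 * \<bar>f x\<bar>"])
    show "(\<lambda>x. f x * p n x) \<in> borel_measurable torus" for n
      using m sq_integrable_trig[OF p, of n] by (simp add: sq_integrable_def borel_measurable_times)
    show "AE x in torus. (\<lambda>n. f x * p n x) \<longlonglongrightarrow> f x * sgn (f x)"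
      using lim by eventually_elim (intro tendsto_intros)
    show "AE x in torus. norm (f x * p n x) \<le> 2 * \<bar>f x\<bar>" for n
    proof (rule AE_I2)
      fix x assume "x \<in> space (torus :: (real^'a) measure)"
      from pb[OF this, of n] show "norm (f x * p n x) \<le> 2 * \<bar>f x\<bar>"
        by (simp add: abs_mult mult.commute[of 2] mult_left_mono)
    qed
  qed (use f m in auto)
  then have "(\<lambda>n::nat. 0::real) \<longlonglongrightarrow> (LINT x|torus. f x * sgn (f x))"
    using orth[OF p] by simp
  then have "(LINT x|torus. f x * sgn (f x)) = 0"
    using LIMSEQ_const_iff by metis
  then have "(LINT x|torus. \<bar>f x\<bar>) = 0" by (simp add: abs_sgn)
  then show ?thesis
    using integral_nonneg_eq_0_iff_AE[of torus "\<lambda>x. \<bar>f x\<bar>"] f by auto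
qed

lemma trig_dense_bounded:
  assumes f: "f \<in> borel_measurable torus" and B: "\<And>x. \<bar>f x\<bar> \<le> B" and e: "e > 0"
  obtains p where "p \<in> trig" "L2_norm (\<lambda>x. f x - p x) < e"
proof -
  obtain p where p: "\<And>n::nat. p n \<in> trig" and pb: "\<And>n x. x \<in> space torus \<Longrightarrow> \<bar>p n x\<bar> \<le> B + 1"
    and lim: "AE x in torus. (\<lambda>n. p n x) \<longlonglongrightarrow> f x"
    using trig_approx_bounded[OF f B] by blast
  have pm: "p n \<in> borel_measurable torus" for n
    using sq_integrable_trig[OF p] by (simp add: sq_integrable_def)
  have "(\<lambda>n. LINT x|torus. (f x - p n x)\<^sup>2) \<longlonglongrightarrow> (LINT x|(torus :: (real ^ 'a) measure). 0)"
  proof (rule integral_dominated_convergence[where w = "\<lambda>x. (2 * B + 1)\<^sup>2"])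
    show "AE x in torus. (\<lambda>n. (f x - p n x)\<^sup>2) \<longlonglongrightarrow> 0"
      using lim
    proof eventually_elim
      case (elim x)
      have "(\<lambda>n. (f x - p n x)\<^sup>2) \<longlonglongrightarrow> (f x - f x)\<^sup>2"
        by (intro tendsto_intros elim)
      then show ?case by simp
    qed
    show "AE x in torus. norm ((f x - p n x)\<^sup>2) \<le> (2 * B + 1)\<^sup>2" for n
    proof (rule AE_I2)
      fix x assume "x \<in> space (torus :: (real^'a) measure)"
      from pb[OF this, of n] B[of x] have "\<bar>f x - p n x\<bar> \<le> 2 * B + 1" by linarith
      then show "norm ((f x - p n x)\<^sup>2) \<le> (2 * B + 1)\<^sup>2"
        by (simp add: power2_le_iff_abs_le)
    qed
  qed (use f pm in auto)
  then have "(\<lambda>n. L2_norm (\<lambda>x. f x - p n x)) \<longlonglongrightarrow> 0"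
    unfolding L2_norm_def using tendsto_real_sqrt[of _ 0] by simp
  then have "eventually (\<lambda>n. L2_norm (\<lambda>x. f x - p n x) < e) sequentially"
    using e by (rule order_tendstoD)
  then obtain n where "L2_norm (\<lambda>x. f x - p n x) < e"
    by (auto simp: eventually_sequentially)
  with p show thesis by (intro that)
qed

text \<open>
  Truncating the values reduces the claim to bounded functions.
\<close>

lemma trig_dense_L2:
  assumes f: "sq_integrable f" and e: "e > 0"
  obtains p where "p \<in> trig" "L2_norm (\<lambda>x. f x - p x) < e"
proof -
  define g where "g n x = max (- real n) (min (real n) (f x))" for n x
  have m: "f \<in> borel_measurable torus" using f by (rule sq_integrable_measurable)
  have gm: "g n \<in> borel_measurable torus" for n
    unfolding g_def using m by measurable
  have "(\<lambda>n. LINT x|torus. (f x - g n x)\<^sup>2) \<longlonglongrightarrow> (LINT x|(torus :: (real ^ 'a) measure). 0)"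
  proof (rule integral_dominated_convergence[where w = "\<lambda>x. (f x)\<^sup>2"])
    show "AE x in torus. (\<lambda>n. (f x - g n x)\<^sup>2) \<longlonglongrightarrow> 0"
    proof (rule AE_I2)
      fix x
      have "g n x = f x" if "n \<ge> nat \<lceil>\<bar>f x\<bar>\<rceil>" for n
      proof -
        have "\<bar>f x\<bar> \<le> real n" using that by linarith
        then show ?thesis unfolding g_def by linarith
      qed
      then have "eventually (\<lambda>n. (f x - g n x)\<^sup>2 = 0) sequentially"
        by (intro eventually_sequentiallyI[of "nat \<lceil>\<bar>f x\<bar>\<rceil>"]) simp
      then show "(\<lambda>n. (f x - g n x)\<^sup>2) \<longlonglongrightarrow> 0" by (rule tendsto_eventually)
    qed
    show "AE x in torus. norm ((f x - g n x)\<^sup>2) \<le> (f x)\<^sup>2" for n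
    proof (rule AE_I2)
      fix x
      have "\<bar>f x - g n x\<bar> \<le> \<bar>f x\<bar>" unfolding g_def by linarith
      then show "norm ((f x - g n x)\<^sup>2) \<le> (f x)\<^sup>2" by (simp add: abs_le_square_iff)
    qed
  qed (use f m gm in \<open>auto simp: sq_integrable_def\<close>)
  then have "(\<lambda>n. L2_norm (\<lambda>x. f x - g n x)) \<longlonglongrightarrow> 0"
    unfolding L2_norm_def using tendsto_real_sqrt[of _ 0] by simp
  then have "eventually (\<lambda>n. L2_norm (\<lambda>x. f x - g n x) < e / 2) sequentially"
    using e by (intro order_tendstoD) auto
  then obtain n where n: "L2_norm (\<lambda>x. f x - g n x) < e / 2"
    by (auto simp: eventually_sequentially)
  have gb: "\<bar>g n x\<bar> \<le> real n" for x unfolding g_def by linarith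
  obtain p where p: "p \<in> trig" "L2_norm (\<lambda>x. g n x - p x) < e / 2"
    using trig_dense_bounded[OF gm gb, of "e / 2"] e by auto
  have "sq_integrable (g n)" using gm gb by (intro sq_integrable_bounded[where B = "real n"]) auto
  then have "L2_norm (\<lambda>x. (f x - g n x) + (g n x - p x)) \<le> L2_norm (\<lambda>x. f x - g n x) + L2_norm (\<lambda>x. g n x - p x)"
    using f sq_integrable_trig[OF p(1)] by (intro L2_norm_triangle sq_integrable_diff)
  with n p show thesis by (intro that[of p]) auto
qed

section \<open>Fourier truncation\<close>

text \<open>
  Lebesgue measure on \<open>\<real>\<^sup>n\<close> is the image of the product measure indexed by the basis vectors, which gives
  Fubini's theorem for products in all coordinates at once.
\<close>

lemma integral_torus_prod:
  fixes g :: "'n::finite \<Rightarrow> real \<Rightarrow> complex"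
  assumes "\<And>i. continuous_on UNIV (g i)"
  shows "(LINT x|torus. (\<Prod>i\<in>UNIV. g i (x $ i))) = (\<Prod>i\<in>UNIV. LINT t:{0..2*pi}|lborel. g i t)"
proof -
  interpret product_sigma_finite "\<lambda>_::real^'n. lborel :: real measure" ..
  define ix :: "real ^ 'n \<Rightarrow> 'n" where "ix b = (THE i. b = axis i 1)" for b
  have ix: "ix (axis i 1) = i" for i
    unfolding ix_def by (rule the_equality) (auto simp: axis_eq_axis)
  have Basis: "(Basis :: (real ^ 'n) set) = (\<lambda>i. axis i 1) ` UNIV"
    by (auto simp: Basis_vec_def)
  have inj: "inj (\<lambda>i::'n. axis i (1::real))" by (auto simp: inj_on_def axis_eq_axis)
  define G where "G i t = indicator {0..2*pi} t *\<^sub>R g i t" for i t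
  have Gi: "integrable lborel (G i)" for i
    using borel_integrable_atLeastAtMost'[of 0 "2 * pi" "g i"] continuous_on_subset[OF assms]
    by (auto simp: G_def[abs_def] set_integrable_def)
  have Gm: "G i \<in> borel_measurable borel" for i
    unfolding G_def
    by (intro borel_measurable_scaleR borel_measurable_indicator borel_measurable_continuous_onI assms) simp
  have coord: "(\<Sum>b\<in>Basis. f b * b $ i) = f (axis i 1)" for f :: "real ^ 'n \<Rightarrow> real" and i
  proof -
    have "(\<Sum>b\<in>Basis. f b * b $ i) = (\<Sum>j\<in>UNIV. f (axis j 1) * axis j 1 $ i)"
      unfolding Basis by (simp add: sum.reindex[OF inj])
    also have "\<dots> = (\<Sum>j\<in>UNIV. if j = i then f (axis j 1) else 0)"
      by (intro sum.cong) (auto simp: axis_def)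
    finally show ?thesis by simp
  qed
  have "(LINT x|torus. (\<Prod>i\<in>UNIV. g i (x $ i)))
      = (LINT x|lborel. indicator (cbox 0 (\<chi> i. 2 * pi)) x *\<^sub>R (\<Prod>i\<in>UNIV. g i (x $ i)))"
    unfolding torus_def by (subst integral_restrict_space) auto
  also have "\<dots> = (LINT x|lborel. (\<Prod>i\<in>UNIV. G i ((x::real^'n) $ i)))"
  proof (rule Bochner_Integration.integral_cong[OF refl])
    fix x :: "real ^ 'n"
    show "indicator (cbox 0 (\<chi> i. 2 * pi)) x *\<^sub>R (\<Prod>i\<in>UNIV. g i (x $ i)) = (\<Prod>i\<in>UNIV. G i (x $ i))"
    proof (cases "x \<in> cbox 0 (\<chi> i. 2 * pi)")
      case True
      then show ?thesis by (auto simp: G_def mem_box_cart intro!: prod.cong)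
    next
      case False
      then obtain i where "x $ i \<notin> {0..2*pi}" by (auto simp: mem_box_cart)
      then have "G i (x $ i) = 0" by (simp add: G_def)
      then have "(\<Prod>i\<in>UNIV. G i (x $ i)) = 0" by (meson UNIV_I finite prod_zero)
      with False show ?thesis by simp
    qed
  qed
  also have "\<dots> = (LINT f|(\<Pi>\<^sub>M b\<in>(Basis::(real^'n) set). lborel). (\<Prod>i\<in>UNIV. G i (f (axis i 1))))"
    by (subst lborel_eq, subst integral_distr)
       (auto simp: coord intro!: borel_measurable_prod measurable_compose[OF _ Gm])
  also have "\<dots> = (LINT f|(\<Pi>\<^sub>M b\<in>(Basis::(real^'n) set). lborel). (\<Prod>b\<in>Basis. G (ix b) (f b)))"
    unfolding Basis by (simp add: prod.reindex[OF inj] ix)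
  also have "\<dots> = (\<Prod>b\<in>Basis. LINT t|lborel. G (ix b) t)"
    by (rule product_integral_prod) (auto intro: Gi)
  also have "\<dots> = (\<Prod>i\<in>UNIV. LINT t|lborel. G i t)"
    unfolding Basis by (simp add: prod.reindex[OF inj] ix)
  finally show ?thesis by (simp add: G_def set_lebesgue_integral_def)
qed

lemma integral_cis_period:
  fixes m :: int
  shows "(LINT t:{0..2*pi}|lborel. cis (of_int m * t)) = (if m = 0 then complex_of_real (2 * pi) else 0)"
proof (cases "m = 0")
  case True
  then show ?thesis by (simp add: set_lebesgue_integral_def scaleR_conv_of_real)
next
  case False
  define F where "F t = cis (of_int m * t) / (\<i> * of_int m)" for t :: real
  have "(F has_vector_derivative cis (of_int m * t)) (at t within {0..2*pi})" for t
  proof -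
    have "((\<lambda>t. cis (of_int m * t)) has_vector_derivative (of_int m *\<^sub>R (\<i> * cis (of_int m * t)))) (at t within {0..2*pi})"
      by (auto intro!: derivative_eq_intros simp: has_vector_derivative_def fun_eq_iff scaleR_conv_of_real)
    from has_vector_derivative_divide[OF this, of "\<i> * of_int m"] False show ?thesis
      by (simp add: F_def[abs_def] scaleR_conv_of_real)
  qed
  moreover have "continuous_on {0..2*pi} (\<lambda>t. cis (of_int m * t))"
    by (intro continuous_intros)
  ultimately have "has_bochner_integral lborel (\<lambda>t. indicator {0..2*pi} t *\<^sub>R cis (of_int m * t)) (F (2*pi) - F 0)"
    by (intro has_bochner_integral_FTC_Icc) auto
  then have "(LINT t:{0..2*pi}|lborel. cis (of_int m * t)) = F (2*pi) - F 0"
    by (simp add: set_lebesgue_integral_def has_bochner_integral_integral_eq)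
  also have "F (2 * pi) = F 0"
    using cis_multiple_2pi[of "of_int m"] by (simp add: F_def mult_ac)
  finally show ?thesis using False by simp
qed

definition torus_volume :: "'n::finite itself \<Rightarrow> real" where
  "torus_volume _ = (2 * pi) ^ CARD('n)"

lemma integral_cis_phase:
  fixes k :: "int ^ 'n"
  shows "(LINT x|torus. cis (phase k x)) = (if k = 0 then complex_of_real (torus_volume TYPE('n)) else 0)"
proof -
  have cis_sum: "cis (sum f A) = (\<Prod>i\<in>A. cis (f i))" if "finite A" for f and A :: "'n set"
    using that by (induction A) (simp_all add: cis_mult[symmetric])
  have "(LINT x|torus. cis (phase k x)) = (LINT x|torus. (\<Prod>i\<in>UNIV. cis (of_int (k $ i) * x $ i)))"
    by (simp add: phase_def cis_sum)
  also have "\<dots> = (\<Prod>i\<in>UNIV. LINT t:{0..2*pi}|lborel. cis (of_int (k $ i) * t))"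
    by (rule integral_torus_prod) (intro continuous_intros)
  also have "\<dots> = (\<Prod>i\<in>(UNIV::'n set). if k $ i = 0 then complex_of_real (2 * pi) else 0)"
    by (simp only: integral_cis_period)
  also have "\<dots> = (if k = 0 then complex_of_real (torus_volume TYPE('n)) else 0)"
  proof (cases "k = 0")
    case False
    then obtain i where "k $ i \<noteq> 0" by (auto simp: vec_eq_iff)
    then have "\<exists>i\<in>UNIV. (if k $ i = 0 then complex_of_real (2 * pi) else 0) = 0" by auto
    then show ?thesis using False by (subst prod_zero) auto
  qed (simp add: torus_volume_def)
  finally show ?thesis .
qed

lemma integral_cos_sin_phase:
  fixes k :: "int ^ 'n"
  shows "(LINT x|torus. cos (phase k x)) = (if k = 0 then torus_volume TYPE('n) else 0)"
    and "(LINT x|torus. sin (phase k x)) = 0"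
proof -
  have c: "integrable torus (\<lambda>x. cos (phase k x))" "integrable torus (\<lambda>x. sin (phase k x))"
    by (auto intro!: sq_integrable_integrable sq_integrable_trig trig.intros)
  have "integrable torus (\<lambda>x. complex_of_real (cos (phase k x)) + \<i> * complex_of_real (sin (phase k x)))"
    using c by auto
  moreover have "cis a = complex_of_real (cos a) + \<i> * complex_of_real (sin a)" for a
    by (simp add: complex_eq_iff)
  ultimately have i: "integrable torus (\<lambda>x. cis (phase k x))" by simp
  show "(LINT x|torus. cos (phase k x)) = (if k = 0 then torus_volume TYPE('n) else 0)"
    using integral_Re[OF i] integral_cis_phase[of k] by simp
  show "(LINT x|torus. sin (phase k x)) = 0"
    using integral_Im[OF i] integral_cis_phase[of k] by (simp split: if_splits)
qed

abbreviation cos_mode :: "int ^ 'n \<Rightarrow> real ^ 'n \<Rightarrow> real" where "cos_mode k \<equiv> (\<lambda>x. cos (phase k x))"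
abbreviation sin_mode :: "int ^ 'n \<Rightarrow> real ^ 'n \<Rightarrow> real" where "sin_mode k \<equiv> (\<lambda>x. sin (phase k x))"

lemma sq_integrable_basis: "sq_integrable (cos_mode k)" "sq_integrable (sin_mode k)"
  by (auto intro: sq_integrable_trig trig.intros)

lemma L2_inner_basis:
  fixes k l :: "int ^ 'n"
  defines "V \<equiv> torus_volume TYPE('n)"
  shows "L2_inner (cos_mode k) (cos_mode l) = ((if l = k then V else 0) + (if l = - k then V else 0)) / 2"
    and "L2_inner (sin_mode k) (sin_mode l) = ((if l = k then V else 0) - (if l = - k then V else 0)) / 2"
    and "L2_inner (sin_mode k) (cos_mode l) = 0"
proof -
  have i: "integrable torus (cos_mode m)" "integrable torus (sin_mode m)" for m :: "int ^ 'n"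
    by (auto intro: sq_integrable_integrable sq_integrable_basis)
  have e: "k - l = 0 \<longleftrightarrow> l = k" "k + l = 0 \<longleftrightarrow> l = - k"
    by (auto simp: add_eq_0_iff)
  have "L2_inner (cos_mode k) (cos_mode l) = (LINT x|torus. (cos_mode (k - l) x + cos_mode (k + l) x) / 2)"
    by (simp add: L2_inner_def cos_times_cos phase_diff phase_add)
  then show "L2_inner (cos_mode k) (cos_mode l) = ((if l = k then V else 0) + (if l = - k then V else 0)) / 2"
    by (simp add: i integral_cos_sin_phase e V_def)
  have "L2_inner (sin_mode k) (sin_mode l) = (LINT x|torus. (cos_mode (k - l) x - cos_mode (k + l) x) / 2)"
    by (simp add: L2_inner_def sin_times_sin phase_diff phase_add)
  then show "L2_inner (sin_mode k) (sin_mode l) = ((if l = k then V else 0) - (if l = - k then V else 0)) / 2"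
    by (simp add: i integral_cos_sin_phase e V_def)
  have "L2_inner (sin_mode k) (cos_mode l) = (LINT x|torus. (sin_mode (k + l) x + sin_mode (k - l) x) / 2)"
    by (simp add: L2_inner_def sin_times_cos phase_diff phase_add)
  then show "L2_inner (sin_mode k) (cos_mode l) = 0"
    by (simp add: i integral_cos_sin_phase)
qed

definition modes :: "nat \<Rightarrow> (int ^ 'n) set" where
  "modes N = {k. \<forall>i. \<bar>k $ i\<bar> \<le> int N}"

lemma finite_modes: "finite (modes N :: (int ^ 'n) set)"
proof (rule finite_subset)
  show "(modes N :: (int ^ 'n) set) \<subseteq> vec_lambda ` (UNIV \<rightarrow>\<^sub>E {- int N..int N})"
  proof
    fix k :: "int ^ 'n" assume "k \<in> modes N"
    then have "vec_nth k \<in> UNIV \<rightarrow>\<^sub>E {- int N..int N}"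
      by (auto simp: modes_def abs_le_iff minus_le_iff)
    then show "k \<in> vec_lambda ` (UNIV \<rightarrow>\<^sub>E {- int N..int N})"
      by (metis image_eqI vec_nth_inverse)
  qed
qed (intro finite_imageI finite_PiE; simp)

lemma uminus_modes: "- k \<in> modes N \<longleftrightarrow> k \<in> modes N"
  by (simp add: modes_def)

lemma modes_mono: "M \<le> N \<Longrightarrow> modes M \<subseteq> modes N"
  unfolding modes_def by (auto intro: order_trans[of _ "int M"])

lemma modes_exhaust: "\<exists>N. k \<in> modes N"
proof -
  have "\<bar>k $ i\<bar> \<le> int (nat (\<Sum>i\<in>UNIV. \<bar>k $ i\<bar>))" for i
    using member_le_sum[of i UNIV "\<lambda>i. \<bar>k $ i\<bar>"] by (simp add: sum_nonneg)
  then show ?thesis unfolding modes_def by blast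
qed

text \<open>
  The index set is symmetric, so every frequency occurs as \<open>k\<close> and as \<open>-k\<close>. This compensates the
  factor \<open>1/2\<close> in \<open>\<integral>cos\<^sup>2\<close> and \<open>\<integral>sin\<^sup>2\<close>: the same normalisation is correct for all modes, including
  \<open>k = 0\<close>, and no half lattice has to be chosen.
\<close>

definition fourier_proj :: "nat \<Rightarrow> ((real ^ 'n) \<Rightarrow> real) \<Rightarrow> real ^ 'n \<Rightarrow> real" where
  "fourier_proj N f x =
     (\<Sum>k\<in>modes N. L2_inner f (cos_mode k) * cos_mode k x + L2_inner f (sin_mode k) * sin_mode k x) / torus_volume TYPE('n)"

lemma fourier_proj_trig: "fourier_proj N (f :: real ^ 'n \<Rightarrow> real) \<in> trig"
proof -
  have "(\<lambda>x. (1 / torus_volume TYPE('n)) * (\<Sum>k\<in>modes N. L2_inner f (cos_mode k) * cos_mode k x + L2_inner f (sin_mode k) * sin_mode k x)) \<in> trig"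
    by (intro trig.intros trig_sum)
  then show ?thesis by (simp add: fourier_proj_def[abs_def])
qed

lemma volume_pos: "torus_volume TYPE('n::finite) > 0"
  by (simp add: torus_volume_def)

lemma L2_inner_fourier_proj:
  fixes f :: "real ^ 'n \<Rightarrow> real"
  assumes g: "sq_integrable g"
  shows "L2_inner (fourier_proj N f) g =
    (\<Sum>k\<in>modes N. L2_inner f (cos_mode k) * L2_inner (cos_mode k) g + L2_inner f (sin_mode k) * L2_inner (sin_mode k) g) / torus_volume TYPE('n)"
proof -
  have "L2_inner (fourier_proj N f) g = L2_inner (\<lambda>x. (1 / torus_volume TYPE('n)) * (\<Sum>k\<in>modes N. L2_inner f (cos_mode k) * cos_mode k x + L2_inner f (sin_mode k) * sin_mode k x)) g"
    by (simp add: fourier_proj_def[abs_def])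
  also have "\<dots> = (1 / torus_volume TYPE('n)) * (\<Sum>k\<in>modes N. L2_inner (\<lambda>x. L2_inner f (cos_mode k) * cos_mode k x + L2_inner f (sin_mode k) * sin_mode k x) g)"
    unfolding L2_inner_cmult_left by (subst L2_inner_sum_left) (auto intro!: sq_integrable_add sq_integrable_cmult sq_integrable_basis g)
  also have "\<dots> = (1 / torus_volume TYPE('n)) * (\<Sum>k\<in>modes N. L2_inner f (cos_mode k) * L2_inner (cos_mode k) g + L2_inner f (sin_mode k) * L2_inner (sin_mode k) g)"
    by (simp add: L2_inner_add_left sq_integrable_cmult sq_integrable_basis g L2_inner_cmult_left)
  finally show ?thesis by simp
qed

text \<open>
  In the inner product with mode \<open>l\<close> exactly the terms \<open>k = l\<close> and \<open>k = -l\<close> survive, each with weight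
  \<open>1/2\<close>; they agree because cosine coefficients are even and sine coefficients odd in \<open>k\<close>.
\<close>

lemma L2_inner_fourier_proj_basis:
  fixes f :: "real ^ 'n \<Rightarrow> real"
  assumes "l \<in> modes N"
  shows "L2_inner (fourier_proj N f) (cos_mode l) = L2_inner f (cos_mode l)"
    and "L2_inner (fourier_proj N f) (sin_mode l) = L2_inner f (sin_mode l)"
proof -
  let ?V = "torus_volume TYPE('n)"
  have even: "L2_inner f (cos_mode (- l)) = L2_inner f (cos_mode l)" and odd: "L2_inner f (sin_mode (- l)) = - L2_inner f (sin_mode l)"
    by (simp_all add: L2_inner_def phase_uminus)
  have m: "- l \<in> modes N" using assms by (simp add: uminus_modes)
  have d: "(\<Sum>k\<in>modes N. a k * (if l = k then ?V else 0)) = a l * ?V"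
    "(\<Sum>k\<in>modes N. a k * (if l = - k then ?V else 0)) = a (- l) * ?V" for a
  proof -
    have "(\<Sum>k\<in>modes N. a k * (if l = k then ?V else 0)) = (\<Sum>k\<in>modes N. if l = k then a k * ?V else 0)"
      by (intro sum.cong) auto
    then show "(\<Sum>k\<in>modes N. a k * (if l = k then ?V else 0)) = a l * ?V"
      using assms by (simp add: finite_modes)
    have "(\<Sum>k\<in>modes N. a k * (if l = - k then ?V else 0)) = (\<Sum>k\<in>modes N. if - l = k then a k * ?V else 0)"
      by (intro sum.cong) auto
    then show "(\<Sum>k\<in>modes N. a k * (if l = - k then ?V else 0)) = a (- l) * ?V"
      using m by (simp add: finite_modes)
  qed
  have "L2_inner (fourier_proj N f) (cos_mode l) =
      ((\<Sum>k\<in>modes N. L2_inner f (cos_mode k) * (if l = k then ?V else 0)) + (\<Sum>k\<in>modes N. L2_inner f (cos_mode k) * (if l = - k then ?V else 0))) / 2 / ?V"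
    by (simp add: L2_inner_fourier_proj sq_integrable_basis L2_inner_basis sum.distrib[symmetric] sum_divide_distrib distrib_left)
  then show "L2_inner (fourier_proj N f) (cos_mode l) = L2_inner f (cos_mode l)"
    unfolding d even using volume_pos[where 'n = 'n] by (simp add: field_simps)
  have cs: "L2_inner (cos_mode k) (sin_mode l) = 0" for k by (simp add: L2_inner_commute[of "cos_mode k"] L2_inner_basis)
  have "L2_inner (fourier_proj N f) (sin_mode l) =
      ((\<Sum>k\<in>modes N. L2_inner f (sin_mode k) * (if l = k then ?V else 0)) - (\<Sum>k\<in>modes N. L2_inner f (sin_mode k) * (if l = - k then ?V else 0))) / 2 / ?V"
    by (simp add: L2_inner_fourier_proj sq_integrable_basis L2_inner_basis cs sum_subtractf[symmetric] sum_divide_distrib right_diff_distrib)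
  then show "L2_inner (fourier_proj N f) (sin_mode l) = L2_inner f (sin_mode l)"
    unfolding d odd using volume_pos[where 'n = 'n] by (simp add: field_simps)
qed

lemma sq_integrable_fourier_proj: "sq_integrable (fourier_proj N f)"
  by (intro sq_integrable_trig fourier_proj_trig)

lemma fourier_proj_orthogonal:
  assumes f: "sq_integrable f" and p: "p \<in> trig"
  shows "\<exists>M. \<forall>N\<ge>M. L2_inner (\<lambda>x. f x - fourier_proj N f x) p = 0"
  using p
proof induction
  case (trig_cos k)
  obtain M where "k \<in> modes M" using modes_exhaust by blast
  then have "\<forall>N\<ge>M. k \<in> modes N" using modes_mono by blast
  then show ?case
    by (intro exI[of _ M]) (simp add: L2_inner_diff_left f sq_integrable_fourier_proj sq_integrable_basis L2_inner_fourier_proj_basis)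
next
  case (trig_sin k)
  obtain M where "k \<in> modes M" using modes_exhaust by blast
  then have "\<forall>N\<ge>M. k \<in> modes N" using modes_mono by blast
  then show ?case
    by (intro exI[of _ M]) (simp add: L2_inner_diff_left f sq_integrable_fourier_proj sq_integrable_basis L2_inner_fourier_proj_basis)
next
  case (trig_add p q)
  then obtain M1 M2 where "\<forall>N\<ge>M1. L2_inner (\<lambda>x. f x - fourier_proj N f x) p = 0"
    "\<forall>N\<ge>M2. L2_inner (\<lambda>x. f x - fourier_proj N f x) q = 0" by blast
  then show ?case
    by (intro exI[of _ "max M1 M2"])
       (auto simp: L2_inner_add_right sq_integrable_diff f sq_integrable_fourier_proj sq_integrable_trig trig_add.hyps)
next
  case (trig_cmult p c)
  then show ?case by (auto simp: L2_inner_cmult_right)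
qed

lemma fourier_proj_orthogonal_self:
  assumes f: "sq_integrable f"
  shows "L2_inner (\<lambda>x. f x - fourier_proj N f x) (fourier_proj N f) = 0"
proof -
  have b: "sq_integrable (\<lambda>x. f x - fourier_proj N f x)"
    by (intro sq_integrable_diff f sq_integrable_fourier_proj)
  have "L2_inner (cos_mode k) (\<lambda>x. f x - fourier_proj N f x) = 0 \<and> L2_inner (sin_mode k) (\<lambda>x. f x - fourier_proj N f x) = 0"
    if "k \<in> modes N" for k
    using L2_inner_fourier_proj_basis[OF that, of f] f
    by (simp add: L2_inner_diff_right sq_integrable_basis sq_integrable_fourier_proj L2_inner_commute[of _ f]
        L2_inner_commute[of _ "fourier_proj N f"])
  then have "L2_inner (fourier_proj N f) (\<lambda>x. f x - fourier_proj N f x) = 0"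
    by (subst L2_inner_fourier_proj[OF b]) (simp add: sum.neutral)
  then show ?thesis by (simp add: L2_inner_commute)
qed

text \<open>
  Parseval's formula for the truncation. It turns the norm in space into finitely many scalar
  functions of time.
\<close>

lemma L2_norm_fourier_proj_power2:
  fixes f :: "real ^ 'n \<Rightarrow> real"
  assumes f: "sq_integrable f"
  shows "(L2_norm (fourier_proj N f))\<^sup>2 =
    (\<Sum>k\<in>modes N. (L2_inner f (cos_mode k))\<^sup>2 + (L2_inner f (sin_mode k))\<^sup>2) / torus_volume TYPE('n)"
proof -
  have "L2_inner (fourier_proj N f) (fourier_proj N f) = L2_inner f (fourier_proj N f)"
    using fourier_proj_orthogonal_self[OF f, of N] f
    by (simp add: L2_inner_diff_left sq_integrable_fourier_proj)
  also have "\<dots> = L2_inner (fourier_proj N f) f" by (rule L2_inner_commute)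
  finally show ?thesis
    unfolding L2_norm_power2 L2_inner_fourier_proj[OF f] by (simp add: L2_inner_commute[of _ f] power2_eq_square)
qed

lemma L2_norm_fourier_proj_le:
  assumes f: "sq_integrable f"
  shows "L2_norm (fourier_proj N f) \<le> L2_norm f"
proof -
  have "L2_inner (fourier_proj N f) (fourier_proj N f) = L2_inner f (fourier_proj N f)"
    using fourier_proj_orthogonal_self[OF f, of N] f
    by (simp add: L2_inner_diff_left sq_integrable_fourier_proj)
  then have "(L2_norm (fourier_proj N f))\<^sup>2 \<le> L2_norm f * L2_norm (fourier_proj N f)"
    using Cauchy_Schwarz_L2[OF f sq_integrable_fourier_proj[of N f]] by (simp add: L2_norm_power2)
  then show ?thesis
    using L2_norm_nonneg[of "fourier_proj N f"] L2_norm_nonneg[of f]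
    by (cases "L2_norm (fourier_proj N f) = 0") (auto simp: power2_eq_square)
qed

text \<open>
  The truncation is the best approximation: once it reproduces the frequencies of a trigonometric
  polynomial \<open>p\<close>, its error is at most that of \<open>p\<close>, and such \<open>p\<close> are dense.
\<close>

lemma fourier_proj_tendsto:
  assumes f: "sq_integrable f"
  shows "(\<lambda>N. L2_norm (\<lambda>x. fourier_proj N f x - f x)) \<longlonglongrightarrow> 0"
proof (rule LIMSEQ_I)
  fix e :: real assume "e > 0"
  then obtain p where p: "p \<in> trig" "L2_norm (\<lambda>x. f x - p x) < e"
    using trig_dense_L2[OF f] by blast
  obtain M where M: "\<forall>N\<ge>M. L2_inner (\<lambda>x. f x - fourier_proj N f x) p = 0"
    using fourier_proj_orthogonal[OF f p(1)] by blast
  have "L2_norm (\<lambda>x. f x - fourier_proj N f x) < e" if "N \<ge> M" for N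
  proof -
    let ?r = "\<lambda>x. f x - fourier_proj N f x"
    have r: "sq_integrable ?r" by (intro sq_integrable_diff f sq_integrable_fourier_proj)
    have "(L2_norm ?r)\<^sup>2 = L2_inner ?r f"
      using fourier_proj_orthogonal_self[OF f, of N] f r
      by (simp add: L2_norm_power2 L2_inner_diff_right sq_integrable_fourier_proj)
    also have "\<dots> = L2_inner ?r (\<lambda>x. f x - p x)"
      using M that f r by (simp add: L2_inner_diff_right sq_integrable_trig p)
    also have "\<dots> \<le> L2_norm ?r * L2_norm (\<lambda>x. f x - p x)"
      using Cauchy_Schwarz_L2[OF r sq_integrable_diff[OF f sq_integrable_trig[OF p(1)]]] by simp
    finally have "L2_norm ?r \<le> L2_norm (\<lambda>x. f x - p x)"
      using L2_norm_nonneg[of ?r] L2_norm_nonneg[of "\<lambda>x. f x - p x"]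
      by (cases "L2_norm ?r = 0") (auto simp: power2_eq_square)
    with p show ?thesis by simp
  qed
  then show "\<exists>M. \<forall>N\<ge>M. norm (L2_norm (\<lambda>x. fourier_proj N f x - f x) - 0) < e"
    by (auto simp: L2_norm_commute[of _ f] L2_norm_nonneg)
qed

section \<open>Weak derivatives\<close>

lemma has_weak_partial_unique:
  assumes "has_weak_partial i f g" "has_weak_partial i f h"
  shows "AE x in torus. g x = h x"
proof -
  have gi: "integrable torus g" and hi: "integrable torus h"
    using assms by (auto simp: has_weak_partial_def)
  have "AE x in torus. g x - h x = 0"
  proof (rule trig_orthogonal_imp_AE_zero)
    show "integrable torus (\<lambda>x. g x - h x)" using gi hi by simp
    fix p :: "real ^ 'a \<Rightarrow> real" assume p: "p \<in> trig"
    have "compact (p ` cbox 0 (\<chi> i. 2 * pi))"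
      by (intro compact_continuous_image trig_continuous p compact_cbox)
    then obtain B where B: "\<And>x. x \<in> cbox 0 (\<chi> i. 2 * pi) \<Longrightarrow> \<bar>p x\<bar> \<le> B"
      using compact_imp_bounded by (force simp: bounded_iff)
    have pm: "p \<in> borel_measurable torus"
      using p by (intro sq_integrable_measurable sq_integrable_trig)
    have mult: "integrable torus (\<lambda>x. k x * p x)" if k: "integrable torus k" for k
    proof (rule Bochner_Integration.integrable_bound)
      show "integrable torus (\<lambda>x. B * k x)" using k by simp
      show "(\<lambda>x. k x * p x) \<in> borel_measurable torus" using k pm by auto
      show "AE x in torus. norm (k x * p x) \<le> norm (B * k x)"
      proof (rule AE_I2)
        fix x assume "x \<in> space (torus :: (real^'a) measure)"
        then have "\<bar>p x\<bar> \<le> \<bar>B\<bar>" using B[of x] by (simp add: space_torus)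
        then show "norm (k x * p x) \<le> norm (B * k x)"
          by (simp add: abs_mult mult.commute[of "\<bar>B\<bar>"] mult_left_mono)
      qed
    qed
    have "(LINT x|torus. g x * p x) = (LINT x|torus. h x * p x)"
      using assms trig_test_function[OF p] by (auto simp: has_weak_partial_def)
    then show "(LINT x|torus. (g x - h x) * p x) = 0"
      using mult[OF gi] mult[OF hi] by (simp add: left_diff_distrib)
  qed
  then show ?thesis by simp
qed

lemma weak_partialI: "has_weak_partial i f g \<Longrightarrow> has_weak_partial i f (weak_partial i f)"
  unfolding weak_partial_def by (rule someI[of "has_weak_partial i f"])

text \<open>
  \<open>weak_partial\<close> is an arbitrary representative among all weak derivatives; uniqueness transfers the
  square integrability of the one that witnesses membership in \<open>H1\<close>.
\<close>

lemma H1_weak_partial: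
  assumes "f \<in> H1"
  shows "has_weak_partial i f (weak_partial i f)" "sq_integrable (weak_partial i f)" "sq_integrable f"
proof -
  obtain g where g: "g \<in> L2" "has_weak_partial i f g" using assms by (auto simp: H1_def)
  show wp: "has_weak_partial i f (weak_partial i f)" using g(2) by (rule weak_partialI)
  have gs: "sq_integrable g" using g(1) by (rule L2_imp_sq_integrable)
  have "AE x in torus. g x = weak_partial i f x" by (rule has_weak_partial_unique[OF g(2) wp])
  then have ae: "AE x in torus. (g x)\<^sup>2 = (weak_partial i f x)\<^sup>2" by eventually_elim simp
  have m: "weak_partial i f \<in> borel_measurable torus" using wp by (auto simp: has_weak_partial_def)
  have "integrable torus (\<lambda>x. (weak_partial i f x)\<^sup>2)"
    by (rule integrable_cong_AE_imp[of _ "\<lambda>x. (g x)\<^sup>2"]) (use gs m ae in \<open>auto simp: sq_integrable_def\<close>)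
  with m show "sq_integrable (weak_partial i f)" by (simp add: sq_integrable_def)
  show "sq_integrable f" using assms by (auto simp: H1_def intro: L2_imp_sq_integrable)
qed

lemma test_function_continuous:
  assumes "\<phi> \<in> test_functions"
  shows "continuous_on UNIV \<phi>" "continuous_on UNIV (\<lambda>x. grad \<phi> x $ i)"
proof -
  have d: "continuously_differentiable k \<phi>" for k using assms by (simp add: test_functions_def)
  show "continuous_on UNIV \<phi>" using d[of 0] by simp
  show "continuous_on UNIV (\<lambda>x. grad \<phi> x $ i)" using d[of "Suc 0"] by simp
qed

lemma has_weak_partial_diff:
  assumes f: "has_weak_partial i f f'" "sq_integrable f" "sq_integrable f'"
    and g: "has_weak_partial i g g'" "sq_integrable g" "sq_integrable g'"
  shows "has_weak_partial i (\<lambda>x. f x - g x) (\<lambda>x. f' x - g' x)"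
  unfolding has_weak_partial_def
proof (intro conjI ballI)
  fix \<phi> :: "real ^ 'a \<Rightarrow> real" assume p: "\<phi> \<in> test_functions"
  have "sq_integrable \<phi>" "sq_integrable (\<lambda>x. grad \<phi> x $ i)"
    by (auto intro!: sq_integrable_continuous test_function_continuous[OF p])
  then have "L2_inner (\<lambda>x. f x - g x) (\<lambda>x. grad \<phi> x $ i) = - L2_inner (\<lambda>x. f' x - g' x) \<phi>"
    using f g p by (simp add: L2_inner_diff_left) (simp add: L2_inner_def has_weak_partial_def)
  then show "(LINT x|torus. (f x - g x) * grad \<phi> x $ i) = - (LINT x|torus. (f' x - g' x) * \<phi> x)"
    by (simp add: L2_inner_def)
qed (use f g in \<open>auto simp: has_weak_partial_def periodic_def\<close>)

lemma has_weak_partial_trig: "has_weak_partial i f g \<Longrightarrow> p \<in> trig \<Longrightarrow> L2_inner f (\<lambda>x. grad p x $ i) = - L2_inner g p"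
  using trig_test_function by (auto simp: has_weak_partial_def L2_inner_def)

lemma fourier_coeff_weak_partial:
  assumes "has_weak_partial i f g"
  shows "L2_inner g (cos_mode k) = of_int (k $ i) * L2_inner f (sin_mode k)"
    and "L2_inner g (sin_mode k) = - of_int (k $ i) * L2_inner f (cos_mode k)"
proof -
  have "L2_inner f (\<lambda>x. - of_int (k $ i) * sin_mode k x) = - L2_inner g (cos_mode k)"
    using has_weak_partial_trig[OF assms trig_cos[of k]] by (simp only: grad_cos)
  then show "L2_inner g (cos_mode k) = of_int (k $ i) * L2_inner f (sin_mode k)" unfolding L2_inner_cmult_right by simp
  have "L2_inner f (\<lambda>x. of_int (k $ i) * cos_mode k x) = - L2_inner g (sin_mode k)"
    using has_weak_partial_trig[OF assms trig_sin[of k]] by (simp only: grad_sin)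
  then show "L2_inner g (sin_mode k) = - of_int (k $ i) * L2_inner f (cos_mode k)" unfolding L2_inner_cmult_right by simp
qed

text \<open>
  Expands an arbitrary linear functional along the truncation. It is applied to the gradient at a
  point and to the weak formulation at a fixed time.
\<close>

lemma linear_fourier_proj:
  fixes f :: "real ^ 'n \<Rightarrow> real" and L :: "(real ^ 'n \<Rightarrow> real) \<Rightarrow> real"
  assumes add: "\<And>p q. p \<in> trig \<Longrightarrow> q \<in> trig \<Longrightarrow> L (\<lambda>x. p x + q x) = L p + L q"
    and cmult: "\<And>c p. p \<in> trig \<Longrightarrow> L (\<lambda>x. c * p x) = c * L p"
  shows "L (fourier_proj N f) =
    (\<Sum>k\<in>modes N. L2_inner f (cos_mode k) * L (cos_mode k) + L2_inner f (sin_mode k) * L (sin_mode k)) / torus_volume TYPE('n)"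
proof -
  have sum: "L (\<lambda>x. \<Sum>k\<in>I. p k x) = (\<Sum>k\<in>I. L (p k))" if "\<And>k. p k \<in> trig" for I :: "(int ^ 'n) set" and p
    using that
  proof (induction I rule: infinite_finite_induct)
    case (insert a I)
    then show ?case using add[of "p a" "\<lambda>x. \<Sum>k\<in>I. p k x"] by (simp add: trig_sum)
  qed (use cmult[of "\<lambda>x. 0" 0] trig_const[of 0] in auto)
  have "L (fourier_proj N f) = L (\<lambda>x. (1 / torus_volume TYPE('n)) * (\<Sum>k\<in>modes N. L2_inner f (cos_mode k) * cos_mode k x + L2_inner f (sin_mode k) * sin_mode k x))"
    by (simp add: fourier_proj_def[abs_def])
  also have "\<dots> = (1 / torus_volume TYPE('n)) * L (\<lambda>x. \<Sum>k\<in>modes N. L2_inner f (cos_mode k) * cos_mode k x + L2_inner f (sin_mode k) * sin_mode k x)"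
    by (intro cmult trig_sum trig.intros)
  also have "L (\<lambda>x. \<Sum>k\<in>modes N. L2_inner f (cos_mode k) * cos_mode k x + L2_inner f (sin_mode k) * sin_mode k x)
      = (\<Sum>k\<in>modes N. L (\<lambda>x. L2_inner f (cos_mode k) * cos_mode k x + L2_inner f (sin_mode k) * sin_mode k x))"
    by (intro sum trig.intros)
  also have "\<dots> = (\<Sum>k\<in>modes N. L2_inner f (cos_mode k) * L (cos_mode k) + L2_inner f (sin_mode k) * L (sin_mode k))"
    by (simp add: add cmult trig.intros)
  finally show ?thesis by simp
qed

text \<open>
  Truncation commutes with differentiation, so truncations of \<open>H1\<close> functions converge together with
  their gradients.
\<close>

lemma grad_fourier_proj:
  assumes "has_weak_partial i f g"
  shows "grad (fourier_proj N f) x $ i = fourier_proj N g x"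
proof -
  have "grad (fourier_proj N f) x $ i = (\<Sum>k\<in>modes N. L2_inner f (cos_mode k) * grad (cos_mode k) x $ i + L2_inner f (sin_mode k) * grad (sin_mode k) x $ i) / torus_volume TYPE('a)"
    by (rule linear_fourier_proj[where L = "\<lambda>p. grad p x $ i"]) (auto intro: grad_add grad_cmult trig_differentiable)
  also have "\<dots> = fourier_proj N g x"
    unfolding fourier_proj_def grad_cos grad_sin fourier_coeff_weak_partial[OF assms]
    by (intro arg_cong2[where f = "(/)"] sum.cong) (auto simp: algebra_simps)
  finally show ?thesis .
qed

lemma weak_partial_by_parts:
  assumes f: "has_weak_partial i f f'" "sq_integrable f" "sq_integrable f'"
    and g: "has_weak_partial i g g'" "sq_integrable g" "sq_integrable g'"
  shows "L2_inner f g' = - L2_inner f' g"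
proof -
  have const0: "(\<lambda>n::nat. L2_norm (\<lambda>x::real^'a. 0)) \<longlonglongrightarrow> 0"
    by (simp add: L2_norm_zero)
  have e: "(\<lambda>x. grad (fourier_proj N g) x $ i) = fourier_proj N g'" for N
    using grad_fourier_proj[OF g(1)] by auto
  have "L2_inner f (fourier_proj N g') = - L2_inner f' (fourier_proj N g)" for N
    using has_weak_partial_trig[OF f(1) fourier_proj_trig[of N g]] by (simp only: e)
  moreover have "(\<lambda>N. L2_inner f (fourier_proj N g')) \<longlonglongrightarrow> L2_inner f g'"
    by (rule L2_inner_tendsto) (use f g in \<open>auto intro: const0 fourier_proj_tendsto sq_integrable_fourier_proj\<close>)
  moreover have lim2: "(\<lambda>N. - L2_inner f' (fourier_proj N g)) \<longlonglongrightarrow> - L2_inner f' g"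
    by (intro tendsto_minus L2_inner_tendsto) (use f g in \<open>auto intro: const0 fourier_proj_tendsto sq_integrable_fourier_proj\<close>)
  ultimately have "(\<lambda>N. - L2_inner f' (fourier_proj N g)) \<longlonglongrightarrow> L2_inner f g'" by simp
  from LIMSEQ_unique[OF this lim2] show ?thesis .
qed

lemma L2_norm_bounded_mult:
  assumes "b \<in> borel_measurable torus" "AE x in torus. \<bar>b x\<bar> \<le> B" "B \<ge> 0" "sq_integrable f"
  shows "L2_norm (\<lambda>x. b x * f x) \<le> B * L2_norm f"
proof -
  have "(L2_norm (\<lambda>x. b x * f x))\<^sup>2 \<le> (B * L2_norm f)\<^sup>2"
  proof -
    have "(LINT x|torus. (b x * f x)\<^sup>2) \<le> (LINT x|torus. B\<^sup>2 * (f x)\<^sup>2)"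
    proof (rule integral_mono_AE)
      show "integrable torus (\<lambda>x. (b x * f x)\<^sup>2)"
        using sq_integrable_bounded_mult[OF assms(1,2,4)] by (simp add: sq_integrable_def)
      show "integrable torus (\<lambda>x. B\<^sup>2 * (f x)\<^sup>2)" using assms by (simp add: sq_integrable_def)
      show "AE x in torus. (b x * f x)\<^sup>2 \<le> B\<^sup>2 * (f x)\<^sup>2"
        using assms(2)
      proof eventually_elim
        case (elim x)
        then have "(b x)\<^sup>2 \<le> B\<^sup>2" by (simp add: power2_le_iff_abs_le assms(3))
        then show ?case by (simp add: power_mult_distrib mult_right_mono)
      qed
    qed
    then show ?thesis
      unfolding power_mult_distrib L2_norm_power2 by (simp add: L2_inner_def power2_eq_square mult_ac)
  qed
  then show ?thesis
    by (rule power2_le_imp_le) (simp add: assms L2_norm_nonneg)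
qed

text \<open>
  Formally \<open>2 w v \<cdot> \<nabla>w = v \<cdot> \<nabla>(w\<^sup>2)\<close>, which integrates to zero if \<open>v\<close> is divergence free. For a truncation
  \<open>q\<close> of \<open>w\<close> this is rigorous, because \<open>q\<^sup>2\<close> is again a trigonometric polynomial and hence an admissible
  test function for the weak divergence of \<open>v\<close>; boundedness of \<open>v\<close> allows passing to the limit.
\<close>

lemma transport_term_vanishes:
  fixes v :: "real ^ 'n \<Rightarrow> real ^ 'n"
  assumes v: "\<And>i. has_weak_partial i (\<lambda>x. v x $ i) (d i)"
    and div: "AE x in torus. (\<Sum>i\<in>UNIV. d i x) = 0"
    and B: "\<And>i. AE x in torus. \<bar>v x $ i\<bar> \<le> B" "B \<ge> 0"
    and w: "\<And>i. has_weak_partial i w (g i)" "sq_integrable w" "\<And>i. sq_integrable (g i)"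
  shows "(\<Sum>i\<in>UNIV. L2_inner (\<lambda>x. v x $ i * g i x) w) = 0"
proof -
  have vm: "(\<lambda>x. v x $ i) \<in> borel_measurable torus" and di: "integrable torus (d i)" for i
    using v[of i] by (auto simp: has_weak_partial_def)
  have vs: "sq_integrable (\<lambda>x. v x $ i)" for i
    by (rule sq_integrable_bounded[OF vm B(1)])
  have "(\<Sum>i\<in>UNIV. L2_inner (\<lambda>x. v x $ i * fourier_proj N (g i) x) (fourier_proj N w)) = 0" for N
  proof -
    define q where "q = fourier_proj N w"
    have q: "q \<in> trig" by (simp add: q_def fourier_proj_trig)
    have qq: "(\<lambda>x. q x * q x) \<in> trig" by (intro trig_mult q)
    have gq: "grad q x $ i = fourier_proj N (g i) x" for x i
      unfolding q_def by (rule grad_fourier_proj[OF w(1)])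
    have "2 * L2_inner (\<lambda>x. v x $ i * fourier_proj N (g i) x) q = - (LINT x|torus. d i x * (q x * q x))" for i
    proof -
      have "L2_inner (\<lambda>x. v x $ i) (\<lambda>x. grad (\<lambda>x. q x * q x) x $ i) = - L2_inner (d i) (\<lambda>x. q x * q x)"
        by (rule has_weak_partial_trig[OF v qq])
      also have "(\<lambda>x. grad (\<lambda>x. q x * q x) x $ i) = (\<lambda>x. 2 * (q x * fourier_proj N (g i) x))"
        by (simp add: grad_mult trig_differentiable q gq mult.commute)
      finally show ?thesis unfolding L2_inner_cmult_right by (simp add: L2_inner_def mult_ac)
    qed
    then have "2 * (\<Sum>i\<in>UNIV. L2_inner (\<lambda>x. v x $ i * fourier_proj N (g i) x) q) = - (\<Sum>i\<in>UNIV. LINT x|torus. d i x * (q x * q x))"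
      by (simp add: sum_distrib_left sum_negf)
    also have "(\<Sum>i\<in>UNIV. LINT x|torus. d i x * (q x * q x)) = (LINT x|torus. (\<Sum>i\<in>UNIV. d i x * (q x * q x)))"
    proof (rule Bochner_Integration.integral_sum[symmetric])
      fix i
      have "compact ((\<lambda>x. q x * q x) ` cbox 0 (\<chi> i. 2 * pi))"
        by (intro compact_continuous_image trig_continuous qq compact_cbox)
      then obtain M where M: "\<And>x. x \<in> cbox 0 (\<chi> i. 2 * pi) \<Longrightarrow> \<bar>q x * q x\<bar> \<le> M"
        using compact_imp_bounded by (force simp: bounded_iff)
      show "integrable torus (\<lambda>x. d i x * (q x * q x))"
      proof (rule Bochner_Integration.integrable_bound)
        show "integrable torus (\<lambda>x. M * d i x)" using di by simp
        show "(\<lambda>x. d i x * (q x * q x)) \<in> borel_measurable torus"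
          using di[of i] sq_integrable_measurable[OF sq_integrable_trig[OF qq]] by auto
        show "AE x in torus. norm (d i x * (q x * q x)) \<le> norm (M * d i x)"
        proof (rule AE_I2)
          fix x assume "x \<in> space (torus :: (real^'n) measure)"
          then have "\<bar>q x * q x\<bar> \<le> \<bar>M\<bar>" using M[of x] by (simp add: space_torus)
          then have "\<bar>d i x\<bar> * \<bar>q x * q x\<bar> \<le> \<bar>d i x\<bar> * \<bar>M\<bar>" by (rule mult_left_mono) simp
          then show "norm (d i x * (q x * q x)) \<le> norm (M * d i x)"
            by (simp add: abs_mult mult.commute)
        qed
      qed
    qed
    also have "\<dots> = 0"
      by (rule integral_eq_zero_AE) (use div in eventually_elim, simp add: sum_distrib_right[symmetric])
    finally show ?thesis by (simp add: q_def)
  qed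
  moreover have "(\<lambda>N. \<Sum>i\<in>UNIV. L2_inner (\<lambda>x. v x $ i * fourier_proj N (g i) x) (fourier_proj N w))
      \<longlonglongrightarrow> (\<Sum>i\<in>UNIV. L2_inner (\<lambda>x. v x $ i * g i x) w)"
  proof (intro tendsto_sum L2_inner_tendsto fourier_proj_tendsto w sq_integrable_bounded_mult[OF vm B(1)] sq_integrable_fourier_proj)
    fix i
    have "(\<lambda>N. B * L2_norm (\<lambda>x. fourier_proj N (g i) x - g i x)) \<longlonglongrightarrow> B * 0"
      by (intro tendsto_intros fourier_proj_tendsto w)
    moreover have "L2_norm (\<lambda>x. v x $ i * fourier_proj N (g i) x - v x $ i * g i x) \<le> B * L2_norm (\<lambda>x. fourier_proj N (g i) x - g i x)" for N
      using L2_norm_bounded_mult[OF vm B(1) B(2), of "\<lambda>x. fourier_proj N (g i) x - g i x"] w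
      by (simp add: sq_integrable_diff sq_integrable_fourier_proj right_diff_distrib)
    ultimately show "(\<lambda>N. L2_norm (\<lambda>x. v x $ i * fourier_proj N (g i) x - v x $ i * g i x)) \<longlonglongrightarrow> 0"
      using Lim_null_comparison[of "\<lambda>N. L2_norm (\<lambda>x. v x $ i * fourier_proj N (g i) x - v x $ i * g i x)"
          "\<lambda>N. B * L2_norm (\<lambda>x. fourier_proj N (g i) x - g i x)" sequentially]
      by (simp add: L2_norm_nonneg)
  qed
  ultimately have "(\<lambda>N::nat. 0::real) \<longlonglongrightarrow> (\<Sum>i\<in>UNIV. L2_inner (\<lambda>x. v x $ i * g i x) w)"
    by simp
  then show ?thesis by (simp add: LIMSEQ_const_iff)
qed

section \<open>The energy identity\<close>

text \<open>
  The integrated form of \<open>(F\<^sup>2)' = 2 f F\<close> for an indefinite integral \<open>F\<close> of a function \<open>f\<close> that is merely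
  integrable. The product \<open>f s * f r\<close> is symmetric, so its integrals over the two triangles
  \<open>r \<le> s\<close> and \<open>s < r\<close> of the square \<open>[0, t]\<^sup>2\<close> are equal.
\<close>

lemma square_of_antiderivative:
  fixes f :: "real \<Rightarrow> real"
  assumes f: "set_integrable lborel {0..t} f"
  shows "set_integrable lborel {0..t} (\<lambda>s. f s * (LBINT r:{0..s}. f r))"
    and "(LBINT s:{0..t}. f s)\<^sup>2 = 2 * (LBINT s:{0..t}. f s * (LBINT r:{0..s}. f r))"
proof -
  define F where "F s = indicator {0..t} s * f s" for s
  have Fi: "integrable lborel F" using f by (simp add: F_def[abs_def] set_integrable_def)
  have Fm[measurable]: "F \<in> borel_measurable borel" using Fi by auto
  define L where "L s r = F s * F r" for s r
  have Li: "integrable (lborel \<Otimes>\<^sub>M lborel) (case_prod L)"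
    unfolding L_def
    by (rule lborel_pair.Fubini_integrable) (use Fi in \<open>auto simp: abs_mult\<close>)
  define T where "T s r = (if r \<le> s then L s r else 0)" for s r
  define T' where "T' s r = (if s < r then L s r else 0)" for s r
  have Tm: "case_prod T \<in> borel_measurable (lborel \<Otimes>\<^sub>M lborel)" "case_prod T' \<in> borel_measurable (lborel \<Otimes>\<^sub>M lborel)"
    unfolding T_def T'_def L_def by measurable
  have Ti: "integrable (lborel \<Otimes>\<^sub>M lborel) (case_prod T)"
    by (rule Bochner_Integration.integrable_bound[OF Li])
       (use Tm in \<open>auto simp: T_def L_def intro!: AE_I2\<close>)
  have Ti': "integrable (lborel \<Otimes>\<^sub>M lborel) (case_prod T')"
    by (rule Bochner_Integration.integrable_bound[OF Li])
       (use Tm in \<open>auto simp: T'_def L_def intro!: AE_I2\<close>)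
  have inner: "(LINT r|lborel. T s r) = indicator {0..t} s * (f s * (LBINT r:{0..s}. f r))" for s
  proof -
    have "(LINT r|lborel. T s r) = (LINT r|lborel. F s * (indicator {..s} r * F r))"
      by (intro Bochner_Integration.integral_cong) (auto simp: T_def L_def)
    also have "\<dots> = F s * (LINT r|lborel. indicator {..s} r * F r)" by simp
    also have "\<dots> = indicator {0..t} s * (f s * (LBINT r:{0..s}. f r))"
    proof (cases "s \<in> {0..t}")
      case True
      then have "(\<lambda>r. indicator {..s} r * F r) = (\<lambda>r. indicator {0..s} r * f r)"
        by (auto simp: F_def indicator_def fun_eq_iff)
      then have "(LINT r|lborel. indicator {..s} r * F r) = (LBINT r:{0..s}. f r)"
        by (simp add: set_lebesgue_integral_def)
      then show ?thesis by (simp add: F_def)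
    qed (simp add: F_def)
    finally show ?thesis .
  qed
  show "set_integrable lborel {0..t} (\<lambda>s. f s * (LBINT r:{0..s}. f r))"
    using lborel_pair.integrable_fst[OF Ti] by (simp add: inner set_integrable_def)
  have "(LINT s|lborel. T' s r) = (LINT s|lborel. T r s)" for r
  proof (rule integral_cong_AE)
    show "AE s in lborel. T' s r = T r s"
      using AE_lborel_singleton[of r] by eventually_elim (auto simp: T'_def T_def L_def)
    show "(\<lambda>s. T' s r) \<in> borel_measurable lborel" "(\<lambda>s. T r s) \<in> borel_measurable lborel"
      unfolding T_def T'_def L_def by measurable
  qed
  then have "(LINT s|lborel. LINT r|lborel. T s r) = integral\<^sup>L (lborel \<Otimes>\<^sub>M lborel) (case_prod T')"
    using lborel_pair.integral_snd[OF Ti'] by simp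
  moreover have "(LINT s|lborel. LINT r|lborel. T s r) = integral\<^sup>L (lborel \<Otimes>\<^sub>M lborel) (case_prod T)"
    using lborel_pair.integral_fst[OF Ti] by simp
  moreover have "integral\<^sup>L (lborel \<Otimes>\<^sub>M lborel) (case_prod T) + integral\<^sup>L (lborel \<Otimes>\<^sub>M lborel) (case_prod T')
      = integral\<^sup>L (lborel \<Otimes>\<^sub>M lborel) (case_prod L)"
    by (subst Bochner_Integration.integral_add[symmetric, OF Ti Ti'])
       (auto simp: T_def T'_def intro!: Bochner_Integration.integral_cong)
  moreover have "integral\<^sup>L (lborel \<Otimes>\<^sub>M lborel) (case_prod L) = (LBINT s:{0..t}. f s)\<^sup>2"
  proof -
    have "(LINT s|lborel. LINT r|lborel. L s r) = (LINT s|lborel. F s)\<^sup>2"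
      by (simp add: L_def power2_eq_square)
    then show ?thesis
      using lborel_pair.integral_fst[OF Li] by (simp add: F_def set_lebesgue_integral_def)
  qed
  ultimately show "(LBINT s:{0..t}. f s)\<^sup>2 = 2 * (LBINT s:{0..t}. f s * (LBINT r:{0..s}. f r))"
    by (simp add: inner set_lebesgue_integral_def)
qed

lemma Linf_norm_AE:
  assumes "Linf_norm f \<le> ennreal M"
  shows "AE x in torus. norm (f x) \<le> max M 0"
proof -
  have "AE x in torus. ennreal (norm (f x)) \<le> Linf_norm f" unfolding Linf_norm_def by (rule esssup_AE)
  then show ?thesis
  proof eventually_elim
    case (elim x)
    then have "ennreal (norm (f x)) \<le> ennreal (max M 0)" using assms
      by (metis ennreal_neg le_zero_eq max_def order_trans linorder_le_cases)
    then show ?case by (subst (asm) ennreal_le_iff) auto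
  qed
qed

text \<open>
  The integrand in time of the weak formulation.
\<close>

definition weak_form where
  "weak_form \<kappa> u \<theta> \<phi> s = (LINT x|torus. (u s x \<bullet> weak_grad (\<theta> s) x) * \<phi> x) +
                       \<kappa> * (LINT x|torus. weak_grad (\<theta> s) x \<bullet> grad \<phi> x)"

lemma is_solution_weak_form:
  assumes "is_solution T \<kappa> u \<theta>\<^sub>0 \<theta>" "t \<in> {0..<T}" "\<phi> \<in> test_functions"
  shows "set_integrable lborel {0..t} (weak_form \<kappa> u \<theta> \<phi>)"
    and "L2_inner (\<theta> t) \<phi> - L2_inner \<theta>\<^sub>0 \<phi> = - (LBINT s:{0..t}. weak_form \<kappa> u \<theta> \<phi> s)"
  using assms unfolding is_solution_def Let_def L2_inner_def weak_form_def[abs_def] by blast+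

lemma weak_form_eq:
  fixes u :: "real \<Rightarrow> real ^ 'n \<Rightarrow> real ^ 'n"
  assumes \<theta>: "\<theta> s \<in> H1" and um: "\<And>i. (\<lambda>x. u s x $ i) \<in> borel_measurable torus"
    and B: "\<And>i. AE x in torus. \<bar>u s x $ i\<bar> \<le> B" and p: "p \<in> trig"
  shows "weak_form \<kappa> u \<theta> p s = (\<Sum>i\<in>UNIV. L2_inner (\<lambda>x. u s x $ i * weak_partial i (\<theta> s) x) p)
       + \<kappa> * (\<Sum>i\<in>UNIV. L2_inner (weak_partial i (\<theta> s)) (\<lambda>x. grad p x $ i))"
proof -
  have g: "sq_integrable (weak_partial i (\<theta> s))" for i by (rule H1_weak_partial[OF \<theta>])
  have "(LINT x|torus. (u s x \<bullet> weak_grad (\<theta> s) x) * p x) = (\<Sum>i\<in>UNIV. L2_inner (\<lambda>x. u s x $ i * weak_partial i (\<theta> s) x) p)"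
    unfolding L2_inner_def inner_vec_def weak_grad_def
    by (simp add: sum_distrib_right)
       (intro Bochner_Integration.integral_sum sq_integrable_mult_integrable sq_integrable_bounded_mult[OF um B] g sq_integrable_trig p)
  moreover have "(LINT x|torus. weak_grad (\<theta> s) x \<bullet> grad p x) = (\<Sum>i\<in>UNIV. L2_inner (weak_partial i (\<theta> s)) (\<lambda>x. grad p x $ i))"
    unfolding L2_inner_def inner_vec_def weak_grad_def
    by simp (intro Bochner_Integration.integral_sum sq_integrable_mult_integrable g sq_integrable_trig trig_grad p)
  ultimately show ?thesis by (simp add: weak_form_def)
qed

lemma L2_norm_le_H1_seminorm: "L2_norm (weak_partial i f) \<le> H1_seminorm f"
  unfolding H1_seminorm_def
  by (rule real_le_rsqrt) (auto intro!: member_le_sum)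

lemma is_solution_L2:
  assumes "is_solution T \<kappa> u \<theta>\<^sub>0 \<theta>" "t \<in> {0..<T}"
  shows "sq_integrable (\<theta> t)"
  using assms unfolding is_solution_def by (auto intro: L2_imp_sq_integrable)

lemma continuous_on_L2_norm_diff:
  assumes 1: "is_solution T \<kappa>1 u \<theta>\<^sub>0 \<theta>1" and 2: "is_solution T \<kappa>2 u \<theta>\<^sub>0 \<theta>2"
  shows "continuous_on {0..<T} (\<lambda>t. L2_norm (\<lambda>x. \<theta>1 t x - \<theta>2 t x))"
  unfolding continuous_on_def
proof
  fix t assume t: "t \<in> {0..<T}"
  have l1: "((\<lambda>s. L2_norm (\<lambda>x. \<theta>1 s x - \<theta>1 t x)) \<longlongrightarrow> 0) (at t within {0..<T})"
    and l2: "((\<lambda>s. L2_norm (\<lambda>x. \<theta>2 s x - \<theta>2 t x)) \<longlongrightarrow> 0) (at t within {0..<T})"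
    using 1 2 t unfolding is_solution_def by blast+
  have l: "((\<lambda>s. L2_norm (\<lambda>x. \<theta>1 s x - \<theta>1 t x) + L2_norm (\<lambda>x. \<theta>2 s x - \<theta>2 t x)) \<longlongrightarrow> 0) (at t within {0..<T})"
    using tendsto_add[OF l1 l2] by simp
  have b: "\<bar>L2_norm (\<lambda>x. \<theta>1 s x - \<theta>2 s x) - L2_norm (\<lambda>x. \<theta>1 t x - \<theta>2 t x)\<bar>
      \<le> L2_norm (\<lambda>x. \<theta>1 s x - \<theta>1 t x) + L2_norm (\<lambda>x. \<theta>2 s x - \<theta>2 t x)" if s: "s \<in> {0..<T}" for s
  proof -
    note i = is_solution_L2[OF 1 s] is_solution_L2[OF 1 t] is_solution_L2[OF 2 s] is_solution_L2[OF 2 t]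
    let ?d = "\<lambda>x. (\<theta>1 s x - \<theta>1 t x) - (\<theta>2 s x - \<theta>2 t x)"
    have d: "L2_norm ?d \<le> L2_norm (\<lambda>x. \<theta>1 s x - \<theta>1 t x) + L2_norm (\<lambda>x. \<theta>2 s x - \<theta>2 t x)"
      by (intro L2_norm_triangle_diff sq_integrable_diff i)
    have "L2_norm (\<lambda>x. (\<theta>1 t x - \<theta>2 t x) + ?d x) \<le> L2_norm (\<lambda>x. \<theta>1 t x - \<theta>2 t x) + L2_norm ?d"
      by (intro L2_norm_triangle sq_integrable_diff i)
    moreover have "L2_norm (\<lambda>x. (\<theta>1 s x - \<theta>2 s x) - ?d x) \<le> L2_norm (\<lambda>x. \<theta>1 s x - \<theta>2 s x) + L2_norm ?d"
      by (intro L2_norm_triangle_diff sq_integrable_diff i)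
    moreover have "(\<lambda>x. (\<theta>1 t x - \<theta>2 t x) + ?d x) = (\<lambda>x. \<theta>1 s x - \<theta>2 s x)"
      "(\<lambda>x. (\<theta>1 s x - \<theta>2 s x) - ?d x) = (\<lambda>x. \<theta>1 t x - \<theta>2 t x)" by auto
    ultimately show ?thesis using d by simp
  qed
  have "((\<lambda>s. L2_norm (\<lambda>x. \<theta>1 s x - \<theta>2 s x) - L2_norm (\<lambda>x. \<theta>1 t x - \<theta>2 t x)) \<longlongrightarrow> 0) (at t within {0..<T})"
  proof (rule Lim_null_comparison[OF _ l])
    show "\<forall>\<^sub>F s in at t within {0..<T}. norm (L2_norm (\<lambda>x. \<theta>1 s x - \<theta>2 s x) - L2_norm (\<lambda>x. \<theta>1 t x - \<theta>2 t x))
        \<le> L2_norm (\<lambda>x. \<theta>1 s x - \<theta>1 t x) + L2_norm (\<lambda>x. \<theta>2 s x - \<theta>2 t x)"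
      unfolding eventually_at_filter using b by (intro always_eventually) auto
  qed
  then show "((\<lambda>t. L2_norm (\<lambda>x. \<theta>1 t x - \<theta>2 t x)) \<longlongrightarrow> L2_norm (\<lambda>x. \<theta>1 t x - \<theta>2 t x)) (at t within {0..<T})"
    by (simp add: LIM_zero_iff)
qed

lemma mult_add_le_sum_squares: "a * (a + b) \<le> 2 * (a\<^sup>2 + b\<^sup>2)" for a b :: real
proof -
  have "0 \<le> (a - b)\<^sup>2 + a\<^sup>2 + 3 * b\<^sup>2" by simp
  also have "\<dots> = 2 * (2 * (a\<^sup>2 + b\<^sup>2) - a * (a + b))" by (simp add: power2_eq_square algebra_simps)
  finally show ?thesis by simp
qed

text \<open>
  The \<open>N\<close>-th truncation of \<open>w = \<theta>\<^sub>\<kappa> - \<theta>\<close> satisfies the identity with \<open>D\<close> replaced by the difference of the two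
  weak formulations tested with the truncation itself. For almost every time this integrand converges,
  the transport term drops out in the limit, and the integrands are dominated by a constant plus a
  multiple of the squared gradients.

  The limit is only determined almost everywhere in time, and outside of the good times the spatial
  inner products of the gradients need not be Borel measurable in \<open>s\<close>. For this reason \<open>D\<close> is a
  separate function, defined as a pointwise limit of measurable ones.
\<close>

lemma energy_identity:
  fixes u :: "real \<Rightarrow> real ^ 'n \<Rightarrow> real ^ 'n"
  assumes u: "Linf_loc_W1inf T u" and div: "divergence_free T u"
    and sol\<kappa>: "is_solution T \<kappa> u \<theta>\<^sub>0 \<theta>\<kappa>" and sol: "is_solution T 0 u \<theta>\<^sub>0 \<theta>"
    and t: "t \<in> {0..<T}"
  obtains D where "set_integrable lborel {0..t} D"
    "AE s in lborel. s \<in> {0..t} \<longrightarrow> D s = \<kappa> * (\<Sum>i\<in>UNIV. L2_inner (weak_partial i (\<theta>\<kappa> s)) (\<lambda>x. weak_partial i (\<theta>\<kappa> s) x - weak_partial i (\<theta> s) x))"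
    "(L2_norm (\<lambda>x. \<theta>\<kappa> t x - \<theta> t x))\<^sup>2 = - 2 * (LBINT s:{0..t}. D s)"
proof -
  let ?V = "torus_volume TYPE('n)"
  define w where "w s = (\<lambda>x. \<theta>\<kappa> s x - \<theta> s x)" for s
  define G where "G i s = (\<lambda>x. weak_partial i (\<theta>\<kappa> s) x - weak_partial i (\<theta> s) x)" for i s
  define A where "A p s = weak_form \<kappa> u \<theta>\<kappa> p s - weak_form 0 u \<theta> p s" for p s
  define h where "h s = (H1_seminorm (\<theta>\<kappa> s))\<^sup>2 + (H1_seminorm (\<theta> s))\<^sup>2" for s
  obtain M0 where M0: "AE s in lborel. s \<in> {0..t} \<longrightarrow>
        u s \<in> W1inf \<and> Linf_norm (u s) \<le> ennreal M0 \<and> Linf_norm (weak_jacobian (u s)) \<le> ennreal M0"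
    using u t unfolding Linf_loc_W1inf_def by blast
  \<comment> \<open>\<open>M\<close> bounds the velocity and \<open>B\<close> below bounds \<open>w\<close> in \<open>L\<^sup>2\<close>, both uniformly on \<open>[0, t]\<close>.\<close>
  define M where "M = max M0 0"
  have w_sq: "sq_integrable (w s)" if "s \<in> {0..t}" for s
    unfolding w_def using that t by (intro sq_integrable_diff is_solution_L2[OF sol\<kappa>] is_solution_L2[OF sol]) auto
  have "continuous_on {0..t} (\<lambda>s. L2_norm (w s))"
    unfolding w_def by (rule continuous_on_subset[OF continuous_on_L2_norm_diff[OF sol\<kappa> sol]]) (use t in auto)
  then have "compact ((\<lambda>s. L2_norm (w s)) ` {0..t})" by (intro compact_continuous_image) auto
  then obtain B0 where B0: "\<And>s. s \<in> {0..t} \<Longrightarrow> \<bar>L2_norm (w s)\<bar> \<le> B0"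
    using compact_imp_bounded by (force simp: bounded_iff)
  define B where "B = max B0 0"
  have B: "L2_norm (w s) \<le> B" if "s \<in> {0..t}" for s using B0[OF that] by (simp add: B_def)
  \<comment> \<open>The initial data cancel, so the pairing of \<open>w\<close> with a fixed \<open>p\<close> is a pure indefinite integral.\<close>
  have A_int: "set_integrable lborel {0..s} (A p)" and w_A: "L2_inner (w s) p = - (LBINT r:{0..s}. A p r)"
    if "s \<in> {0..t}" "p \<in> trig" for s p
  proof -
    have s: "s \<in> {0..<T}" using that t by auto
    note \<phi> = trig_test_function[OF that(2)]
    note 1 = is_solution_weak_form[OF sol\<kappa> s \<phi>] and 2 = is_solution_weak_form[OF sol s \<phi>]
    show "set_integrable lborel {0..s} (A p)"
      unfolding A_def by (intro set_integral_diff 1 2)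
    have "(LBINT r:{0..s}. A p r) = (LBINT r:{0..s}. weak_form \<kappa> u \<theta>\<kappa> p r) - (LBINT r:{0..s}. weak_form 0 u \<theta> p r)"
      unfolding A_def by (intro set_integral_diff 1 2)
    moreover have "L2_inner (w s) p = L2_inner (\<theta>\<kappa> s) p - L2_inner (\<theta> s) p"
      unfolding w_def using s that(2)
      by (intro L2_inner_diff_left is_solution_L2[OF sol\<kappa>] is_solution_L2[OF sol] sq_integrable_trig)
    ultimately show "L2_inner (w s) p = - (LBINT r:{0..s}. A p r)" using 1(2) 2(2) by simp
  qed
  define \<Phi> where "\<Phi> N s = (\<Sum>k\<in>modes N. L2_inner (w s) (cos_mode k) * A (cos_mode k) s + L2_inner (w s) (sin_mode k) * A (sin_mode k) s) / ?V" for N s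
  have coef: "set_integrable lborel {0..t} (\<lambda>s. L2_inner (w s) p * A p s)"
      "(L2_inner (w t) p)\<^sup>2 = - 2 * (LBINT s:{0..t}. L2_inner (w s) p * A p s)" if p: "p \<in> trig" for p
  proof -
    have tt: "t \<in> {0..t}" using t by auto
    note sq = square_of_antiderivative[OF A_int[OF tt p]]
    have e: "s \<in> {0..t} \<Longrightarrow> A p s * (LBINT r:{0..s}. A p r) = - (L2_inner (w s) p * A p s)" for s
      using w_A[OF _ p] by simp
    have "set_integrable lborel {0..t} (\<lambda>s. - (L2_inner (w s) p * A p s))"
      using sq(1) by (subst set_integrable_cong[OF refl refl e[symmetric]]) auto
    then show i: "set_integrable lborel {0..t} (\<lambda>s. L2_inner (w s) p * A p s)"
      unfolding set_integrable_def by simp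
    have "(LBINT s:{0..t}. A p s * (LBINT r:{0..s}. A p r)) = (LBINT s:{0..t}. - (L2_inner (w s) p * A p s))"
      by (rule set_lebesgue_integral_cong) (use e in auto)
    then show "(L2_inner (w t) p)\<^sup>2 = - 2 * (LBINT s:{0..t}. L2_inner (w s) p * A p s)"
      using sq(2) w_A[OF tt p] by (simp add: set_lebesgue_integral_def)
  qed
  have \<Phi>_int: "set_integrable lborel {0..t} (\<Phi> N)"
    and proj_\<Phi>: "(L2_norm (fourier_proj N (w t)))\<^sup>2 = - 2 * (LBINT s:{0..t}. \<Phi> N s)" for N
  proof -
    have i: "integrable lborel (\<lambda>s. indicator {0..t} s * (L2_inner (w s) (cos_mode k) * A (cos_mode k) s))"
      "integrable lborel (\<lambda>s. indicator {0..t} s * (L2_inner (w s) (sin_mode k) * A (sin_mode k) s))" for k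
      using coef(1)[OF trig_cos] coef(1)[OF trig_sin] by (simp_all add: set_integrable_def)
    have e: "indicator {0..t} s * \<Phi> N s = (\<Sum>k\<in>modes N. indicator {0..t} s * (L2_inner (w s) (cos_mode k) * A (cos_mode k) s) + indicator {0..t} s * (L2_inner (w s) (sin_mode k) * A (sin_mode k) s)) / ?V" for s
      by (simp add: \<Phi>_def sum_distrib_left distrib_left)
    show "set_integrable lborel {0..t} (\<Phi> N)"
      unfolding set_integrable_def real_scaleR_def e
      by (intro Bochner_Integration.integrable_divide Bochner_Integration.integrable_sum Bochner_Integration.integrable_add i)
    have \<Phi>_eq: "(LBINT s:{0..t}. \<Phi> N s) = (\<Sum>k\<in>modes N. (LBINT s:{0..t}. L2_inner (w s) (cos_mode k) * A (cos_mode k) s) + (LBINT s:{0..t}. L2_inner (w s) (sin_mode k) * A (sin_mode k) s)) / ?V"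
      unfolding set_lebesgue_integral_def real_scaleR_def e by (simp add: i)
    have "t \<in> {0..t}" using t by simp
    then have "(L2_norm (fourier_proj N (w t)))\<^sup>2 = (\<Sum>k\<in>modes N. (L2_inner (w t) (cos_mode k))\<^sup>2 + (L2_inner (w t) (sin_mode k))\<^sup>2) / ?V"
      by (rule L2_norm_fourier_proj_power2[OF w_sq])
    also have "\<dots> = (\<Sum>k\<in>modes N. - 2 * ((LBINT s:{0..t}. L2_inner (w s) (cos_mode k) * A (cos_mode k) s) + (LBINT s:{0..t}. L2_inner (w s) (sin_mode k) * A (sin_mode k) s))) / ?V"
      unfolding coef(2)[OF trig_cos] coef(2)[OF trig_sin] by (simp only: distrib_left)
    also have "\<dots> = - 2 * (LBINT s:{0..t}. \<Phi> N s)"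
      unfolding \<Phi>_eq sum_distrib_left[symmetric] by simp
    finally show "(L2_norm (fourier_proj N (w t)))\<^sup>2 = - 2 * (LBINT s:{0..t}. \<Phi> N s)" .
  qed
  define D0 where "D0 s = \<kappa> * (\<Sum>i\<in>UNIV. L2_inner (weak_partial i (\<theta>\<kappa> s)) (G i s))" for s
  \<comment> \<open>A dominating function in terms of the squared seminorms, whose integrability in time is part of
    being a solution; products of seminorms are reduced to squares by \<open>2ab \<le> a\<^sup>2 + b\<^sup>2\<close>.\<close>
  define W where "W s = real CARD('n) * M * B * (2 + h s) + \<bar>\<kappa>\<bar> * real CARD('n) * (2 * h s)" for s
  have good: "AE s in lborel. s \<in> {0..t} \<longrightarrow> (\<lambda>N. \<Phi> N s) \<longlonglongrightarrow> D0 s \<and> (\<forall>N. \<bar>\<Phi> N s\<bar> \<le> W s)"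
  proof -
    have "AE s in lborel. s \<in> {0..<T} \<longrightarrow> \<theta>\<kappa> s \<in> H1" "AE s in lborel. s \<in> {0..<T} \<longrightarrow> \<theta> s \<in> H1"
      using sol\<kappa> sol by (auto simp: is_solution_def)
    moreover note M0 div[unfolded divergence_free_def]
    ultimately show ?thesis
    proof eventually_elim
      case (elim s)
      show ?case
      proof
        assume s: "s \<in> {0..t}"
        then have sT: "s \<in> {0..<T}" using t by auto
        have \<theta>\<kappa>1: "\<theta>\<kappa> s \<in> H1" and \<theta>1: "\<theta> s \<in> H1" using elim sT by auto
        have uW: "u s \<in> W1inf" and uM: "Linf_norm (u s) \<le> ennreal M0" using elim s by auto
        have ud: "AE x in torus. (\<Sum>i\<in>UNIV. weak_partial i (\<lambda>y. u s y $ i) x) = 0" using elim sT by auto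
        have uwp: "has_weak_partial i (\<lambda>x. u s x $ i) (weak_partial i (\<lambda>y. u s y $ i))" for i
          using uW weak_partialI by (fastforce simp: W1inf_def)
        have um: "(\<lambda>x. u s x $ i) \<in> borel_measurable torus" for i
          using uwp[of i] by (auto simp: has_weak_partial_def)
        have uB: "AE x in torus. \<bar>u s x $ i\<bar> \<le> M" for i
          using Linf_norm_AE[OF uM]
          by eventually_elim (metis M_def component_le_norm_cart order_trans)
        have M0': "M \<ge> 0" by (simp add: M_def)
        note d\<kappa> = H1_weak_partial[OF \<theta>\<kappa>1] and d = H1_weak_partial[OF \<theta>1]
        have Gs: "sq_integrable (G i s)" for i unfolding G_def by (intro sq_integrable_diff d\<kappa> d)
        have Gw: "has_weak_partial i (w s) (G i s)" for i
          unfolding G_def w_def by (intro has_weak_partial_diff d\<kappa> d)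
        have ws: "sq_integrable (w s)" by (rule w_sq[OF s])
        have A_eq: "A p s = (\<Sum>i\<in>UNIV. L2_inner (\<lambda>x. u s x $ i * G i s x) p)
            + \<kappa> * (\<Sum>i\<in>UNIV. L2_inner (weak_partial i (\<theta>\<kappa> s)) (\<lambda>x. grad p x $ i))" if p: "p \<in> trig" for p
        proof -
          have "L2_inner (\<lambda>x. u s x $ i * G i s x) p = L2_inner (\<lambda>x. u s x $ i * weak_partial i (\<theta>\<kappa> s) x) p
              - L2_inner (\<lambda>x. u s x $ i * weak_partial i (\<theta> s) x) p" for i
            unfolding G_def right_diff_distrib
            by (intro L2_inner_diff_left sq_integrable_bounded_mult[OF um uB] d\<kappa> d sq_integrable_trig p)
          then show ?thesis
            unfolding A_def weak_form_eq[of \<theta>\<kappa> s u, OF \<theta>\<kappa>1 um uB p] weak_form_eq[of \<theta> s u, OF \<theta>1 um uB p]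
            by (simp add: sum_subtractf)
        qed
        have \<Phi>_eq: "\<Phi> N s = (\<Sum>i\<in>UNIV. L2_inner (\<lambda>x. u s x $ i * G i s x) (fourier_proj N (w s)))
            + \<kappa> * (\<Sum>i\<in>UNIV. L2_inner (weak_partial i (\<theta>\<kappa> s)) (fourier_proj N (G i s)))" for N
        proof -
          have uG: "sq_integrable (\<lambda>x. u s x $ i * G i s x)" for i
            by (intro sq_integrable_bounded_mult[OF um uB] Gs)
          \<comment> \<open>For a fixed good time the weak formulation is linear in the test function, so the
            sum over modes is the weak formulation tested with the truncation.\<close>
          have "A (fourier_proj N (w s)) s = \<Phi> N s"
            unfolding \<Phi>_def
          proof (rule linear_fourier_proj[where L = "\<lambda>p. A p s"])
            fix p q :: "real ^ 'n \<Rightarrow> real" and c :: real assume p: "p \<in> trig"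
            show "A (\<lambda>x. c * p x) s = c * A p s"
              using p by (simp add: A_eq trig_cmult grad_cmult trig_differentiable L2_inner_cmult_right sum_distrib_left algebra_simps)
            assume q: "q \<in> trig"
            show "A (\<lambda>x. p x + q x) s = A p s + A q s"
              using p q by (simp add: A_eq trig_add grad_add trig_differentiable L2_inner_add_right uG d\<kappa> sq_integrable_trig trig_grad
                  sum.distrib distrib_left)
          qed
          then show ?thesis
            using A_eq[OF fourier_proj_trig[of N "w s"]] by (simp add: grad_fourier_proj[OF Gw])
        qed
        have "(\<lambda>N. \<Phi> N s) \<longlonglongrightarrow> (\<Sum>i\<in>UNIV. L2_inner (\<lambda>x. u s x $ i * G i s x) (w s))
            + \<kappa> * (\<Sum>i\<in>UNIV. L2_inner (weak_partial i (\<theta>\<kappa> s)) (G i s))"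
          unfolding \<Phi>_eq
          by (intro tendsto_intros L2_inner_tendsto fourier_proj_tendsto sq_integrable_fourier_proj ws Gs d\<kappa>
              sq_integrable_bounded_mult[OF um uB]) (simp_all add: L2_norm_zero)
        moreover have "(\<Sum>i\<in>UNIV. L2_inner (\<lambda>x. u s x $ i * G i s x) (w s)) = 0"
          by (rule transport_term_vanishes[OF uwp ud uB M0' Gw ws Gs])
        ultimately have "(\<lambda>N. \<Phi> N s) \<longlonglongrightarrow> D0 s" by (simp add: D0_def)
        moreover have "\<bar>\<Phi> N s\<bar> \<le> W s" for N
        proof -
          define a where "a = H1_seminorm (\<theta>\<kappa> s)"
          define b where "b = H1_seminorm (\<theta> s)"
          have ab: "a \<ge> 0" "b \<ge> 0" by (auto simp: a_def b_def H1_seminorm_def sum_nonneg)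
          have Gab: "L2_norm (G i s) \<le> a + b" for i
          proof -
            have "L2_norm (G i s) \<le> L2_norm (weak_partial i (\<theta>\<kappa> s)) + L2_norm (weak_partial i (\<theta> s))"
              unfolding G_def by (intro L2_norm_triangle_diff d\<kappa> d)
            then show ?thesis
              using L2_norm_le_H1_seminorm[of i "\<theta>\<kappa> s"] L2_norm_le_H1_seminorm[of i "\<theta> s"] by (simp add: a_def b_def)
          qed
          have "\<bar>L2_inner (\<lambda>x. u s x $ i * G i s x) (fourier_proj N (w s))\<bar> \<le> M * (a + b) * B" for i
          proof -
            have "\<bar>L2_inner (\<lambda>x. u s x $ i * G i s x) (fourier_proj N (w s))\<bar>
                \<le> L2_norm (\<lambda>x. u s x $ i * G i s x) * L2_norm (fourier_proj N (w s))"
              by (intro Cauchy_Schwarz_L2 sq_integrable_bounded_mult[OF um uB] Gs sq_integrable_fourier_proj)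
            also have "\<dots> \<le> (M * (a + b)) * B"
            proof (rule mult_mono)
              show "L2_norm (\<lambda>x. u s x $ i * G i s x) \<le> M * (a + b)"
                by (rule order_trans[OF L2_norm_bounded_mult[OF um uB M0' Gs]]) (intro mult_left_mono Gab M0')
              show "L2_norm (fourier_proj N (w s)) \<le> B"
                by (rule order_trans[OF L2_norm_fourier_proj_le[OF ws] B[OF s]])
            qed (use ab M0' in \<open>auto simp: L2_norm_nonneg\<close>)
            finally show ?thesis .
          qed
          then have "\<bar>\<Sum>i\<in>UNIV. L2_inner (\<lambda>x. u s x $ i * G i s x) (fourier_proj N (w s))\<bar> \<le> (\<Sum>i\<in>(UNIV::'n set). M * (a + b) * B)"
            by (intro order_trans[OF sum_abs] sum_mono)
          moreover have "\<bar>L2_inner (weak_partial i (\<theta>\<kappa> s)) (fourier_proj N (G i s))\<bar> \<le> a * (a + b)" for i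
          proof -
            have "\<bar>L2_inner (weak_partial i (\<theta>\<kappa> s)) (fourier_proj N (G i s))\<bar> \<le> L2_norm (weak_partial i (\<theta>\<kappa> s)) * L2_norm (fourier_proj N (G i s))"
              by (intro Cauchy_Schwarz_L2 d\<kappa> sq_integrable_fourier_proj)
            also have "\<dots> \<le> a * (a + b)"
              by (rule mult_mono) (use ab in \<open>auto simp: L2_norm_nonneg a_def[symmetric] L2_norm_le_H1_seminorm[of i "\<theta>\<kappa> s", folded a_def]
                  intro: order_trans[OF L2_norm_fourier_proj_le[OF Gs] Gab]\<close>)
            finally show ?thesis .
          qed
          then have "\<bar>\<Sum>i\<in>UNIV. L2_inner (weak_partial i (\<theta>\<kappa> s)) (fourier_proj N (G i s))\<bar> \<le> (\<Sum>i\<in>(UNIV::'n set). a * (a + b))"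
            by (intro order_trans[OF sum_abs] sum_mono)
          then have "\<bar>\<kappa> * (\<Sum>i\<in>UNIV. L2_inner (weak_partial i (\<theta>\<kappa> s)) (fourier_proj N (G i s)))\<bar> \<le> \<bar>\<kappa>\<bar> * (\<Sum>i\<in>(UNIV::'n set). a * (a + b))"
            unfolding abs_mult by (rule mult_left_mono) simp
          ultimately have "\<bar>\<Phi> N s\<bar> \<le> real CARD('n) * (M * (a + b) * B) + \<bar>\<kappa>\<bar> * (real CARD('n) * (a * (a + b)))"
            unfolding \<Phi>_eq by simp
          also have "\<dots> \<le> W s"
          proof -
            have hab: "h s = a\<^sup>2 + b\<^sup>2" by (simp add: h_def a_def b_def)
            have "2 * a * 1 \<le> a\<^sup>2 + 1\<^sup>2" "2 * b * 1 \<le> b\<^sup>2 + 1\<^sup>2" by (rule sum_squares_bound)+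
            then have "a + b \<le> 2 + h s" unfolding hab using ab by simp
            moreover have "a * (a + b) \<le> 2 * h s"
            proof -
              show ?thesis unfolding hab by (rule mult_add_le_sum_squares)
            qed
            ultimately have "real CARD('n) * M * B * (a + b) \<le> real CARD('n) * M * B * (2 + h s)"
              "\<bar>\<kappa>\<bar> * real CARD('n) * (a * (a + b)) \<le> \<bar>\<kappa>\<bar> * real CARD('n) * (2 * h s)"
              using M0' by (auto intro!: mult_left_mono simp: B_def)
            then show ?thesis by (simp add: W_def mult_ac)
          qed
          finally show ?thesis .
        qed
        ultimately show "(\<lambda>N. \<Phi> N s) \<longlonglongrightarrow> D0 s \<and> (\<forall>N. \<bar>\<Phi> N s\<bar> \<le> W s)" by blast
      qed
    qed
  qed
  define D where "D s = lim (\<lambda>N. indicator {0..t} s * \<Phi> N s)" for s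
  have \<Phi>m: "(\<lambda>s. indicator {0..t} s * \<Phi> N s) \<in> borel_measurable lborel" for N
    using \<Phi>_int[of N] by (auto simp: set_integrable_def)
  have Dm: "D \<in> borel_measurable lborel"
    unfolding D_def by (rule borel_measurable_lim_metric) (rule \<Phi>m)
  have D: "AE s in lborel. (\<lambda>N. indicator {0..t} s * \<Phi> N s) \<longlonglongrightarrow> D s \<and> D s = indicator {0..t} s * D0 s"
    using good
  proof eventually_elim
    case (elim s)
    have "(\<lambda>N. indicator {0..t} s * \<Phi> N s) \<longlonglongrightarrow> indicator {0..t} s * D0 s"
      using elim by (cases "s \<in> {0..t}") auto
    moreover from this have "D s = indicator {0..t} s * D0 s" unfolding D_def by (rule limI)
    ultimately show ?case by simp
  qed
  have hi: "set_integrable lborel {0..t} h"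
    unfolding h_def using sol\<kappa> sol t by (intro set_integral_add) (auto simp: is_solution_def)
  have Wi: "integrable lborel (\<lambda>s. indicator {0..t} s * W s)"
  proof -
    have "integrable lborel (\<lambda>s. indicator {0..t} s * h s)" using hi by (simp add: set_integrable_def)
    moreover have "integrable lborel (\<lambda>s. indicator {0..t} s * (2::real))"
      by (simp add: integrable_real_indicator emeasure_lborel_Icc_eq)
    ultimately have "integrable lborel (\<lambda>s. (real CARD('n) * M * B) * (indicator {0..t} s * 2 + indicator {0..t} s * h s)
        + (\<bar>\<kappa>\<bar> * real CARD('n) * 2) * (indicator {0..t} s * h s))"
      by (intro Bochner_Integration.integrable_add Bochner_Integration.integrable_mult_right)
    then show ?thesis by (simp add: W_def algebra_simps)
  qed
  have bound: "AE s in lborel. norm (indicator {0..t} s * \<Phi> N s) \<le> indicator {0..t} s * W s" for N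
    using good by eventually_elim (auto simp: indicator_def)
  have Dlim: "AE s in lborel. (\<lambda>N. indicator {0..t} s * \<Phi> N s) \<longlonglongrightarrow> D s" using D by eventually_elim blast
  have Di: "integrable lborel D"
    by (rule integrable_dominated_convergence[OF Dm \<Phi>m Wi Dlim bound])
  have Dconv: "(\<lambda>N. LINT s|lborel. indicator {0..t} s * \<Phi> N s) \<longlonglongrightarrow> (LINT s|lborel. D s)"
    by (rule integral_dominated_convergence[OF Dm \<Phi>m Wi Dlim bound])
  have D0': "indicator {0..t} s * D s = D s" for s
    by (cases "s \<in> {0..t}") (simp_all add: D_def lim_const)
  show thesis
  proof
    show "set_integrable lborel {0..t} D" using Di by (simp add: set_integrable_def D0')
    show "AE s in lborel. s \<in> {0..t} \<longrightarrow> D s = \<kappa> * (\<Sum>i\<in>UNIV. L2_inner (weak_partial i (\<theta>\<kappa> s)) (\<lambda>x. weak_partial i (\<theta>\<kappa> s) x - weak_partial i (\<theta> s) x))"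
      using D by eventually_elim (auto simp: D0_def G_def)
    have wt: "sq_integrable (w t)" using w_sq t by auto
    have "(\<lambda>N. L2_inner (fourier_proj N (w t)) (fourier_proj N (w t))) \<longlonglongrightarrow> L2_inner (w t) (w t)"
      by (intro L2_inner_tendsto fourier_proj_tendsto sq_integrable_fourier_proj wt)
    then have "(\<lambda>N. - 2 * (LBINT s:{0..t}. \<Phi> N s)) \<longlonglongrightarrow> (L2_norm (w t))\<^sup>2"
      unfolding L2_norm_power2[symmetric] proj_\<Phi> .
    moreover have "(\<lambda>N. - 2 * (LBINT s:{0..t}. \<Phi> N s)) \<longlonglongrightarrow> - 2 * (LBINT s:{0..t}. D s)"
      using Dconv by (intro tendsto_intros) (simp add: set_lebesgue_integral_def D0')
    ultimately have "(L2_norm (w t))\<^sup>2 = - 2 * (LBINT s:{0..t}. D s)" by (rule LIMSEQ_unique)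
    then show "(L2_norm (\<lambda>x. \<theta>\<kappa> t x - \<theta> t x))\<^sup>2 = - 2 * (LBINT s:{0..t}. D s)" by (simp add: w_def)
  qed
qed

section \<open>Comparison of the two solutions\<close>

lemma H1_seminorm_power2: "(H1_seminorm f)\<^sup>2 = (\<Sum>i\<in>UNIV. (L2_norm (weak_partial i f))\<^sup>2)"
  by (simp add: H1_seminorm_def sum_nonneg)

lemma H1_seminorm_nonneg: "H1_seminorm f \<ge> 0"
  by (simp add: H1_seminorm_def sum_nonneg)

lemma H1_inner_le:
  assumes "f \<in> H1" "g \<in> H1"
  shows "(\<Sum>i\<in>UNIV. L2_inner (weak_partial i f) (weak_partial i g)) \<le> H1_seminorm f * H1_seminorm g"
proof -
  have "(\<Sum>i\<in>UNIV. L2_inner (weak_partial i f) (weak_partial i g)) \<le> (\<Sum>i\<in>UNIV. \<bar>L2_norm (weak_partial i f)\<bar> * \<bar>L2_norm (weak_partial i g)\<bar>)"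
    using Cauchy_Schwarz_L2[OF H1_weak_partial(2)[OF assms(1)] H1_weak_partial(2)[OF assms(2)]]
    by (intro sum_mono) (simp add: L2_norm_nonneg abs_le_iff)
  also have "\<dots> \<le> L2_set (\<lambda>i. L2_norm (weak_partial i f)) UNIV * L2_set (\<lambda>i. L2_norm (weak_partial i g)) UNIV"
    by (rule L2_set_mult_ineq)
  finally show ?thesis by (simp add: L2_set_def H1_seminorm_def)
qed

lemma H2_weak_partial2_le: "L2_norm (weak_partial i (weak_partial i f)) \<le> H2_seminorm f"
proof -
  have "(L2_norm (weak_partial i (weak_partial i f)))\<^sup>2 \<le> (\<Sum>j\<in>UNIV. (L2_norm (weak_partial i (weak_partial j f)))\<^sup>2)"
    by (rule member_le_sum[of i UNIV "\<lambda>j. (L2_norm (weak_partial i (weak_partial j f)))\<^sup>2"]) auto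
  also have "\<dots> \<le> (\<Sum>i\<in>UNIV. \<Sum>j\<in>UNIV. (L2_norm (weak_partial i (weak_partial j f)))\<^sup>2)"
    by (rule member_le_sum[of i UNIV "\<lambda>i. \<Sum>j\<in>UNIV. (L2_norm (weak_partial i (weak_partial j f)))\<^sup>2"]) (auto intro: sum_nonneg)
  finally show ?thesis unfolding H2_seminorm_def by (rule real_le_rsqrt)
qed

text \<open>
  Integration by parts gives \<open>|\<nabla>g|\<^sup>2 - \<langle>\<nabla>f, \<nabla>g\<rangle> = \<langle>f - g, \<Delta>g\<rangle>\<close>. The dimension enters because each of the
  \<open>n\<close> terms of the Laplacian is estimated by the full second order seminorm. By the two bounds the
  right hand side is at most half of \<open>|\<nabla>g|\<^sup>2\<close>, and the Cauchy--Schwarz inequality for \<open>\<langle>\<nabla>f, \<nabla>g\<rangle>\<close> concludes.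
\<close>

lemma gradient_comparison:
  fixes f g :: "real ^ 'n \<Rightarrow> real"
  assumes f: "f \<in> H1" and g: "g \<in> H2"
    and bound: "H2_seminorm g \<le> K * (H1_seminorm g)\<^sup>2"
    and close: "real CARD('n) * K * L2_norm (\<lambda>x. f x - g x) \<le> 1 / 2"
  shows "H1_seminorm g \<le> 2 * H1_seminorm f"
proof -
  have g1: "g \<in> H1" and gi: "\<And>i. weak_partial i g \<in> H1" using g by (auto simp: H2_def)
  note df = H1_weak_partial[OF f] and dg = H1_weak_partial[OF g1] and ddg = H1_weak_partial[OF gi]
  let ?w = "\<lambda>x. f x - g x"
  have ws: "sq_integrable ?w" by (intro sq_integrable_diff df dg)
  have wi: "has_weak_partial i ?w (\<lambda>x. weak_partial i f x - weak_partial i g x)" for i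
    by (intro has_weak_partial_diff df dg)
  have "(H1_seminorm g)\<^sup>2 - (\<Sum>i\<in>UNIV. L2_inner (weak_partial i f) (weak_partial i g)) \<le> (\<Sum>i\<in>(UNIV::'n set). L2_norm ?w * H2_seminorm g)"
    unfolding H1_seminorm_power2 sum_subtractf[symmetric]
  proof (rule sum_mono)
    fix i :: 'n
    have "(L2_norm (weak_partial i g))\<^sup>2 - L2_inner (weak_partial i f) (weak_partial i g) = - L2_inner (\<lambda>x. weak_partial i f x - weak_partial i g x) (weak_partial i g)"
      by (simp add: L2_norm_power2 L2_inner_diff_left df dg)
    also have "\<dots> = L2_inner ?w (weak_partial i (weak_partial i g))"
      by (subst weak_partial_by_parts[OF wi ws _ ddg(1,3,2)]) (simp_all add: sq_integrable_diff df dg)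
    also have "\<dots> \<le> L2_norm ?w * L2_norm (weak_partial i (weak_partial i g))"
      using Cauchy_Schwarz_L2[OF ws ddg(2)[of i i]] by simp
    also have "\<dots> \<le> L2_norm ?w * H2_seminorm g"
      by (intro mult_left_mono H2_weak_partial2_le L2_norm_nonneg)
    finally show "(L2_norm (weak_partial i g))\<^sup>2 - L2_inner (weak_partial i f) (weak_partial i g) \<le> L2_norm ?w * H2_seminorm g" .
  qed
  also have "\<dots> = real CARD('n) * L2_norm ?w * H2_seminorm g" by simp
  also have "\<dots> \<le> real CARD('n) * L2_norm ?w * (K * (H1_seminorm g)\<^sup>2)"
    by (intro mult_left_mono bound) (simp add: L2_norm_nonneg)
  also have "\<dots> = (real CARD('n) * K * L2_norm ?w) * (H1_seminorm g)\<^sup>2" by simp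
  also have "\<dots> \<le> 1 / 2 * (H1_seminorm g)\<^sup>2" by (intro mult_right_mono close) simp
  finally have "(H1_seminorm g)\<^sup>2 \<le> 2 * (H1_seminorm f * H1_seminorm g)"
    using H1_inner_le[OF f g1] by linarith
  then show ?thesis
    using H1_seminorm_nonneg[of g] H1_seminorm_nonneg[of f]
    by (cases "H1_seminorm g = 0") (auto simp: power2_eq_square)
qed

text \<open>
  With \<open>a = |\<nabla>\<theta>\<^sub>\<kappa>|\<close> the integrand \<open>\<langle>\<nabla>\<theta>\<^sub>\<kappa>, \<nabla>\<theta>\<rangle> - a\<^sup>2\<close> of the energy identity is at most \<open>a (2 a) - a\<^sup>2 = a\<^sup>2\<close>.
\<close>

lemma dissipation_bounds_distance:
  fixes u :: "real \<Rightarrow> real ^ 'n \<Rightarrow> real ^ 'n"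
  assumes u: "Linf_loc_W1inf T u" and div: "divergence_free T u"
    and sol\<kappa>: "is_solution T \<kappa> u \<theta>\<^sub>0 \<theta>\<kappa>" and sol: "is_solution T 0 u \<theta>\<^sub>0 \<theta>"
    and t: "t \<in> {0..<T}" and \<kappa>: "\<kappa> > 0"
    and cmp: "AE s in lborel. s \<in> {0..t} \<longrightarrow> H1_seminorm (\<theta> s) \<le> 2 * H1_seminorm (\<theta>\<kappa> s)"
  shows "(L2_norm (\<lambda>x. \<theta>\<kappa> t x - \<theta> t x))\<^sup>2 \<le> 2 * \<kappa> * (LBINT s:{0..t}. (H1_seminorm (\<theta>\<kappa> s))\<^sup>2)"
proof -
  obtain D where Di: "set_integrable lborel {0..t} D"
    and D: "AE s in lborel. s \<in> {0..t} \<longrightarrow> D s = \<kappa> * (\<Sum>i\<in>UNIV. L2_inner (weak_partial i (\<theta>\<kappa> s)) (\<lambda>x. weak_partial i (\<theta>\<kappa> s) x - weak_partial i (\<theta> s) x))"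
    and id: "(L2_norm (\<lambda>x. \<theta>\<kappa> t x - \<theta> t x))\<^sup>2 = - 2 * (LBINT s:{0..t}. D s)"
    using energy_identity[OF u div sol\<kappa> sol t] by blast
  have h: "set_integrable lborel {0..t} (\<lambda>s. (H1_seminorm (\<theta>\<kappa> s))\<^sup>2)"
    using sol\<kappa> t by (auto simp: is_solution_def)
  have "AE s in lborel. s \<in> {0..<T} \<longrightarrow> \<theta>\<kappa> s \<in> H1" "AE s in lborel. s \<in> {0..<T} \<longrightarrow> \<theta> s \<in> H1"
    using sol\<kappa> sol by (auto simp: is_solution_def)
  then have ae: "AE s in lborel. s \<in> {0..t} \<longrightarrow> - D s \<le> \<kappa> * (H1_seminorm (\<theta>\<kappa> s))\<^sup>2"
    using D cmp
  proof eventually_elim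
    case (elim s)
    show ?case
    proof
      assume s: "s \<in> {0..t}"
      then have 1: "\<theta>\<kappa> s \<in> H1" "\<theta> s \<in> H1" using elim t by auto
      let ?a = "H1_seminorm (\<theta>\<kappa> s)"
      have "(\<Sum>i\<in>UNIV. L2_inner (weak_partial i (\<theta>\<kappa> s)) (\<lambda>x. weak_partial i (\<theta>\<kappa> s) x - weak_partial i (\<theta> s) x))
          = ?a\<^sup>2 - (\<Sum>i\<in>UNIV. L2_inner (weak_partial i (\<theta>\<kappa> s)) (weak_partial i (\<theta> s)))"
        by (simp add: L2_inner_diff_right H1_weak_partial[OF 1(1)] H1_weak_partial[OF 1(2)] sum_subtractf H1_seminorm_power2 L2_norm_power2)
      moreover have "(\<Sum>i\<in>UNIV. L2_inner (weak_partial i (\<theta>\<kappa> s)) (weak_partial i (\<theta> s))) \<le> ?a * H1_seminorm (\<theta> s)"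
        by (rule H1_inner_le[OF 1])
      moreover have "?a * H1_seminorm (\<theta> s) \<le> ?a * (2 * ?a)"
        using elim s by (intro mult_left_mono H1_seminorm_nonneg) auto
      ultimately have "- (\<Sum>i\<in>UNIV. L2_inner (weak_partial i (\<theta>\<kappa> s)) (\<lambda>x. weak_partial i (\<theta>\<kappa> s) x - weak_partial i (\<theta> s) x)) \<le> ?a\<^sup>2"
        by (simp add: power2_eq_square)
      then have "\<kappa> * - (\<Sum>i\<in>UNIV. L2_inner (weak_partial i (\<theta>\<kappa> s)) (\<lambda>x. weak_partial i (\<theta>\<kappa> s) x - weak_partial i (\<theta> s) x)) \<le> \<kappa> * ?a\<^sup>2"
        using \<kappa> by (intro mult_left_mono) auto
      then show "- D s \<le> \<kappa> * ?a\<^sup>2" using elim s by simp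
    qed
  qed
  have "(LBINT s:{0..t}. - D s) \<le> (LBINT s:{0..t}. \<kappa> * (H1_seminorm (\<theta>\<kappa> s))\<^sup>2)"
    unfolding set_lebesgue_integral_def
  proof (rule integral_mono_AE)
    show "integrable lborel (\<lambda>s. indicator {0..t} s *\<^sub>R - D s)" using Di by (simp add: set_integrable_def)
    show "integrable lborel (\<lambda>s. indicator {0..t} s *\<^sub>R (\<kappa> * (H1_seminorm (\<theta>\<kappa> s))\<^sup>2))"
      using integrable_mult_right[OF h[unfolded set_integrable_def], of \<kappa>] by (simp add: mult_ac)
    show "AE s in lborel. indicator {0..t} s *\<^sub>R - D s \<le> indicator {0..t} s *\<^sub>R (\<kappa> * (H1_seminorm (\<theta>\<kappa> s))\<^sup>2)"
      using ae by eventually_elim (auto simp: indicator_def)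
  qed
  moreover have "(LBINT s:{0..t}. - D s) = - (LBINT s:{0..t}. D s)"
    by (simp add: set_lebesgue_integral_def)
  moreover have "(LBINT s:{0..t}. \<kappa> * (H1_seminorm (\<theta>\<kappa> s))\<^sup>2) = \<kappa> * (LBINT s:{0..t}. (H1_seminorm (\<theta>\<kappa> s))\<^sup>2)"
    by (rule set_integral_mult_right)
  ultimately show ?thesis unfolding id by simp
qed

lemma set_integral_le_nn_integral:
  fixes h :: "real \<Rightarrow> real"
  assumes h: "set_integrable lborel {0..t} h" "\<And>s. h s \<ge> 0" and t: "t < T"
  shows "ennreal (LBINT s:{0..t}. h s) \<le> (\<integral>\<^sup>+s\<in>{0..<T}. ennreal (h s) \<partial>lborel)"
proof -
  have "ennreal (LBINT s:{0..t}. h s) = (\<integral>\<^sup>+s. ennreal (indicator {0..t} s * h s) \<partial>lborel)"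
    using h unfolding set_lebesgue_integral_def set_integrable_def
    by (subst nn_integral_eq_integral) (auto intro!: AE_I2)
  also have "\<dots> \<le> (\<integral>\<^sup>+s\<in>{0..<T}. ennreal (h s) \<partial>lborel)"
    by (rule nn_integral_mono) (use t in \<open>auto simp: indicator_def\<close>)
  finally show ?thesis .
qed

text \<open>
  On the last stretch of length \<open>d\<close> the integrand is at least \<open>c / d\<^sup>2\<close>, which contributes \<open>c / d\<close>; this
  exceeds any finite value \<open>r\<close> of the integral when \<open>d \<le> c / (r + 1)\<close>.
\<close>

lemma nn_integral_blowup:
  fixes h :: "real \<Rightarrow> real"
  assumes c: "c > 0" and T: "T > 0"
    and lower: "AE s in lborel. s \<in> {0..<T} \<longrightarrow> h s \<ge> c / (T - s)\<^sup>2"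
  shows "(\<integral>\<^sup>+s\<in>{0..<T}. ennreal (h s) \<partial>lborel) = \<infinity>"
proof (rule ccontr)
  let ?I = "\<integral>\<^sup>+s\<in>{0..<T}. ennreal (h s) \<partial>lborel"
  assume "?I \<noteq> \<infinity>"
  then obtain r where r: "?I = ennreal r" "r \<ge> 0" by (cases ?I) auto
  define d where "d = min T (c / (r + 1))"
  have d: "0 < d" "d \<le> T" using c T r by (auto simp: d_def)
  have "d \<le> c / (r + 1)" by (simp add: d_def)
  then have dr: "d * (r + 1) \<le> c" using r by (subst (asm) pos_le_divide_eq) auto
  have "ennreal (c / d) = (\<integral>\<^sup>+s\<in>{T-d..<T}. ennreal (c / d\<^sup>2) \<partial>lborel)"
  proof -
    have "(\<integral>\<^sup>+s\<in>{T-d..<T}. ennreal (c / d\<^sup>2) \<partial>lborel) = ennreal (c / d\<^sup>2) * ennreal d"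
      using d by (subst nn_integral_cmult_indicator) auto
    also have "\<dots> = ennreal (c / d)" using d c by (simp add: ennreal_mult[symmetric] power2_eq_square)
    finally show ?thesis by simp
  qed
  also have "\<dots> \<le> ?I"
  proof (rule nn_integral_mono_AE)
    show "AE s in lborel. ennreal (c / d\<^sup>2) * indicator {T-d..<T} s \<le> ennreal (h s) * indicator {0..<T} s"
      using lower
    proof eventually_elim
      case (elim s)
      show ?case
      proof (cases "s \<in> {T-d..<T}")
        case True
        then have "(T - s)\<^sup>2 \<le> d\<^sup>2" by (intro power_mono) auto
        then have "c / d\<^sup>2 \<le> c / (T - s)\<^sup>2" using True c d by (intro divide_left_mono) auto
        also have "\<dots> \<le> h s" using elim True d by auto
        finally show ?thesis using True d by (auto intro: ennreal_leI)
      qed simp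
    qed
  qed
  finally have "c / d \<le> r" using r by simp
  moreover have "r + 1 \<le> c / d" using d(1) dr by (subst pos_le_divide_eq) (auto simp: mult.commute)
  ultimately show False by simp
qed

text \<open>
  The superlevel set within \<open>[0, t]\<close> is compact, so it has a least element, and by the intermediate
  value theorem the function equals \<open>e\<close> there.
\<close>

lemma first_hitting_time:
  fixes f :: "real \<Rightarrow> real"
  assumes f: "continuous_on {0..<T} f" and 0: "f 0 < e" and t: "t \<in> {0..<T}" "f t \<ge> e"
  obtains r where "r \<in> {0..<T}" "f r = e" "\<And>s. s \<in> {0..r} \<Longrightarrow> f s \<le> e"
proof -
  have ct: "continuous_on {0..t} f" by (rule continuous_on_subset[OF f]) (use t in auto)
  define S where "S = {0..t} \<inter> f -` {e..}"
  have "closed S" unfolding S_def using ct by (intro continuous_on_closed_vimage[THEN iffD1, rule_format, of "{0..t}" f "{e..}", unfolded Int_commute[of "f -` {e..}"]]) auto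
  moreover have "bounded S" unfolding S_def by (rule bounded_subset[of "{0..t}"]) auto
  moreover have "S \<noteq> {}" using t by (auto simp: S_def)
  ultimately obtain r where r: "r \<in> S" "\<And>s. s \<in> S \<Longrightarrow> r \<le> s"
    using compact_attains_inf[of S] by (auto simp: compact_eq_bounded_closed)
  have less: "f s < e" if "s \<in> {0..<r}" for s
    using r(2)[of s] r(1) that by (force simp: S_def)
  have r0: "0 \<le> r" "r \<le> t" "f r \<ge> e" using r(1) by (auto simp: S_def)
  obtain x where x: "0 \<le> x" "x \<le> r" "f x = e"
    using IVT'[of f 0 e r] r0 0 continuous_on_subset[OF ct, of "{0..r}"] by auto
  with less[of x] have "x = r" by force
  with x have "f r = e" by simp
  with less r0 t show thesis by (intro that[of r]) (auto simp: less_le)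
qed

text \<open>
  The constant is chosen so that \<open>2 \<chi> |\<theta>\<^sub>0|\<^sup>2 = \<epsilon>\<^sup>2 / 2\<close> for the threshold \<open>\<epsilon> = |\<theta>\<^sub>0| / (2 C n)\<close> below which the
  gradients can be compared.
\<close>

theorem proposition1p5:
  fixes C :: real
  assumes "CARD('n::finite) \<ge> 2"
    and "C \<ge> 1"
  shows "\<exists>chi>0. \<forall>(T::real) (u :: real \<Rightarrow> real ^ 'n \<Rightarrow> real ^ 'n) (\<theta>\<^sub>0 :: real ^ 'n \<Rightarrow> real)
             (\<theta>\<kappa> :: real \<Rightarrow> real \<Rightarrow> real ^ 'n \<Rightarrow> real) (\<theta> :: real \<Rightarrow> real ^ 'n \<Rightarrow> real).
      T > 0 \<longrightarrow>
      Linf_loc_W1inf T u \<longrightarrow>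
      divergence_free T u \<longrightarrow>
      \<theta>\<^sub>0 \<in> H2 \<longrightarrow>
      (LINT x|torus. \<theta>\<^sub>0 x) = 0 \<longrightarrow>
      \<not> (AE x in torus. \<theta>\<^sub>0 x = 0) \<longrightarrow>
      (\<forall>\<kappa>>0. is_solution T \<kappa> u \<theta>\<^sub>0 (\<theta>\<kappa> \<kappa>)) \<longrightarrow>
      is_solution T 0 u \<theta>\<^sub>0 \<theta> \<longrightarrow>
      (\<forall>t\<in>{0..<T}.
         \<theta> t \<in> H2 \<and>
         H2_seminorm (\<theta> t) \<le> C * (H1_seminorm (\<theta> t))\<^sup>2 / L2_norm \<theta>\<^sub>0 \<and>
         1 / (C * (T - t)) \<le> H1_seminorm (\<theta> t) / L2_norm \<theta>\<^sub>0) \<longrightarrow>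
      (AE t in lborel. t \<in> {0..<T} \<longrightarrow>
         Linf_norm (weak_jacobian (u t)) \<le> ennreal (C / (T - t))) \<longrightarrow>
      (\<forall>\<kappa>>0. ennreal \<kappa> * (\<integral>\<^sup>+t\<in>{0..<T}. ennreal ((H1_seminorm (\<theta>\<kappa> \<kappa> t))\<^sup>2) \<partial>lborel)
               > ennreal (chi * (L2_norm \<theta>\<^sub>0)\<^sup>2))"
proof (rule exI[of _ "1 / (16 * C\<^sup>2 * (real CARD('n))\<^sup>2)"], intro conjI allI impI)
  let ?n = "real CARD('n)"
  let ?chi = "1 / (16 * C\<^sup>2 * ?n\<^sup>2)"
  show "?chi > 0" using assms by simp
  fix T :: real and u :: "real \<Rightarrow> real ^ 'n \<Rightarrow> real ^ 'n" and \<theta>\<^sub>0 :: "real ^ 'n \<Rightarrow> real"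
    and \<theta>\<kappa> :: "real \<Rightarrow> real \<Rightarrow> real ^ 'n \<Rightarrow> real" and \<theta> :: "real \<Rightarrow> real ^ 'n \<Rightarrow> real" and \<kappa> :: real
  assume T: "T > 0" and u: "Linf_loc_W1inf T u" and div: "divergence_free T u" and init: "\<theta>\<^sub>0 \<in> H2"
    and nz: "\<not> (AE x in torus. \<theta>\<^sub>0 x = 0)" and sols: "\<forall>\<kappa>>0. is_solution T \<kappa> u \<theta>\<^sub>0 (\<theta>\<kappa> \<kappa>)"
    and sol: "is_solution T 0 u \<theta>\<^sub>0 \<theta>"
    and hyp: "\<forall>t\<in>{0..<T}.
         \<theta> t \<in> H2 \<and>
         H2_seminorm (\<theta> t) \<le> C * (H1_seminorm (\<theta> t))\<^sup>2 / L2_norm \<theta>\<^sub>0 \<and>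
         1 / (C * (T - t)) \<le> H1_seminorm (\<theta> t) / L2_norm \<theta>\<^sub>0"
    and \<kappa>: "\<kappa> > 0"
  define N where "N = L2_norm \<theta>\<^sub>0"
  define \<epsilon> where "\<epsilon> = N / (2 * C * ?n)"
  define w where "w t = L2_norm (\<lambda>x. \<theta>\<kappa> \<kappa> t x - \<theta> t x)" for t
  define I where "I = (\<integral>\<^sup>+t\<in>{0..<T}. ennreal ((H1_seminorm (\<theta>\<kappa> \<kappa> t))\<^sup>2) \<partial>lborel)"
  have sol\<kappa>: "is_solution T \<kappa> u \<theta>\<^sub>0 (\<theta>\<kappa> \<kappa>)" using sols \<kappa> by blast
  have s0: "sq_integrable \<theta>\<^sub>0" using init by (auto simp: H2_def intro: H1_weak_partial)
  have C0: "C > 0" using assms by simp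
  have N0: "N > 0"
  proof (rule ccontr)
    assume "\<not> N > 0"
    then have "(L2_norm \<theta>\<^sub>0)\<^sup>2 = 0" using L2_norm_nonneg[of \<theta>\<^sub>0] by (simp add: N_def)
    then have "L2_inner \<theta>\<^sub>0 \<theta>\<^sub>0 = 0" using L2_norm_power2[of \<theta>\<^sub>0] by simp
    then have "(LINT x|torus. (\<theta>\<^sub>0 x)\<^sup>2) = 0" by (simp add: L2_inner_def power2_eq_square)
    moreover have "integrable torus (\<lambda>x. (\<theta>\<^sub>0 x)\<^sup>2)" using s0 by (simp add: sq_integrable_def)
    then have "(LINT x|torus. (\<theta>\<^sub>0 x)\<^sup>2) = 0 \<longleftrightarrow> (AE x in torus. (\<theta>\<^sub>0 x)\<^sup>2 = 0)"
      by (rule integral_nonneg_eq_0_iff_AE) simp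
    ultimately have "AE x in torus. (\<theta>\<^sub>0 x)\<^sup>2 = 0" by blast
    then have "AE x in torus. \<theta>\<^sub>0 x = 0" by eventually_elim simp
    with nz show False by blast
  qed
  have \<epsilon>0: "\<epsilon> > 0" using N0 C0 by (simp add: \<epsilon>_def)
  show "ennreal (?chi * (L2_norm \<theta>\<^sub>0)\<^sup>2) < ennreal \<kappa> * (\<integral>\<^sup>+t\<in>{0..<T}. ennreal ((H1_seminorm (\<theta>\<kappa> \<kappa> t))\<^sup>2) \<partial>lborel)"
  proof (rule ccontr)
    assume "\<not> ?thesis"
    then have small: "ennreal \<kappa> * I \<le> ennreal (?chi * N\<^sup>2)" by (simp add: I_def N_def)
    have ae1: "AE s in lborel. s \<in> {0..<T} \<longrightarrow> \<theta>\<kappa> \<kappa> s \<in> H1"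
      using sol\<kappa> by (auto simp: is_solution_def)
    have cmp: "H1_seminorm (\<theta> s) \<le> 2 * H1_seminorm (\<theta>\<kappa> \<kappa> s)"
      if "s \<in> {0..<T}" "\<theta>\<kappa> \<kappa> s \<in> H1" "w s \<le> \<epsilon>" for s
    proof (rule gradient_comparison[where K = "C / N"])
      show "H2_seminorm (\<theta> s) \<le> C / N * (H1_seminorm (\<theta> s))\<^sup>2" using hyp that by (simp add: N_def)
      have "?n * (C / N) * w s \<le> ?n * (C / N) * \<epsilon>"
        using that C0 N0 by (intro mult_left_mono) auto
      also have "\<dots> = 1 / 2" using C0 N0 by (simp add: \<epsilon>_def)
      finally show "?n * (C / N) * L2_norm (\<lambda>x. \<theta>\<kappa> \<kappa> s x - \<theta> s x) \<le> 1 / 2" by (simp add: w_def)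
    qed (use that hyp in auto)
    have w0: "w 0 = 0"
    proof -
      have 0: "0 \<in> {0..<T}" using T by simp
      have "AE x in torus. \<theta>\<kappa> \<kappa> 0 x = \<theta>\<^sub>0 x" "AE x in torus. \<theta> 0 x = \<theta>\<^sub>0 x"
        using sol\<kappa> sol by (auto simp: is_solution_def)
      then have "AE x in torus. \<theta>\<kappa> \<kappa> 0 x - \<theta> 0 x = 0" by eventually_elim simp
      then have "w 0 = L2_norm (\<lambda>x::real^'n. 0)"
        unfolding w_def using sq_integrable_diff[OF is_solution_L2[OF sol\<kappa> 0] is_solution_L2[OF sol 0]]
        by (intro L2_norm_cong_AE) (auto simp: sq_integrable_def)
      then show ?thesis by (simp add: L2_norm_zero)
    qed
    have never: "w t < \<epsilon>" if t: "t \<in> {0..<T}" for t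
    proof (rule ccontr)
      assume "\<not> w t < \<epsilon>"
      then obtain r where r: "r \<in> {0..<T}" "w r = \<epsilon>" "\<And>s. s \<in> {0..r} \<Longrightarrow> w s \<le> \<epsilon>"
        using first_hitting_time[OF continuous_on_L2_norm_diff[OF sol\<kappa> sol, folded w_def], of \<epsilon> t] w0 \<epsilon>0 t by auto
      let ?J = "LBINT s:{0..r}. (H1_seminorm (\<theta>\<kappa> \<kappa> s))\<^sup>2"
      have "AE s in lborel. s \<in> {0..r} \<longrightarrow> H1_seminorm (\<theta> s) \<le> 2 * H1_seminorm (\<theta>\<kappa> \<kappa> s)"
        using ae1 by eventually_elim (use cmp r in auto)
      then have "\<epsilon>\<^sup>2 \<le> 2 * \<kappa> * ?J"
        using dissipation_bounds_distance[OF u div sol\<kappa> sol r(1) \<kappa>] r(2) by (simp add: w_def)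
      moreover have "\<kappa> * ?J \<le> ?chi * N\<^sup>2"
      proof -
        have "set_integrable lborel {0..r} (\<lambda>s. (H1_seminorm (\<theta>\<kappa> \<kappa> s))\<^sup>2)"
          using sol\<kappa> r(1) by (auto simp: is_solution_def)
        then have J: "ennreal ?J \<le> I" unfolding I_def using r(1) by (intro set_integral_le_nn_integral) auto
        have "ennreal (\<kappa> * ?J) = ennreal \<kappa> * ennreal ?J"
          using \<kappa> by (intro ennreal_mult) (auto simp: set_lebesgue_integral_def intro!: Bochner_Integration.integral_nonneg)
        also have "\<dots> \<le> ennreal \<kappa> * I" by (intro mult_left_mono J) simp
        also note small
        finally show ?thesis using N0 C0 by (subst (asm) ennreal_le_iff) auto
      qed
      ultimately have "\<epsilon>\<^sup>2 \<le> 2 * (?chi * N\<^sup>2)" by linarith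
      moreover have "2 * (?chi * N\<^sup>2) = \<epsilon>\<^sup>2 / 2"
        using C0 by (simp add: \<epsilon>_def power_divide power_mult_distrib)
      ultimately have "\<epsilon>\<^sup>2 \<le> \<epsilon>\<^sup>2 / 2" by (rule ord_le_eq_trans)
      then show False using zero_less_power[OF \<epsilon>0, of 2] by linarith
    qed
    have "AE s in lborel. s \<in> {0..<T} \<longrightarrow> (H1_seminorm (\<theta>\<kappa> \<kappa> s))\<^sup>2 \<ge> (N / (2 * C))\<^sup>2 / (T - s)\<^sup>2"
      using ae1
    proof eventually_elim
      case (elim s)
      show ?case
      proof
        assume s: "s \<in> {0..<T}"
        have "1 / (C * (T - s)) \<le> H1_seminorm (\<theta> s) / N" using hyp s by (simp add: N_def)
        then have "1 / (C * (T - s)) * N \<le> H1_seminorm (\<theta> s)" by (simp only: pos_le_divide_eq[OF N0])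
        then have "N / (C * (T - s)) \<le> H1_seminorm (\<theta> s)" by simp
        also have "\<dots> \<le> 2 * H1_seminorm (\<theta>\<kappa> \<kappa> s)"
          using cmp[OF s] elim s never[OF s] by simp
        finally have "N / (C * (T - s)) \<le> H1_seminorm (\<theta>\<kappa> \<kappa> s) * 2" by (simp only: mult.commute)
        then have "N / (C * (T - s)) / 2 \<le> H1_seminorm (\<theta>\<kappa> \<kappa> s)"
          by (rule pos_divide_le_eq[THEN iffD2, rotated]) simp
        then have "N / (2 * C) / (T - s) \<le> H1_seminorm (\<theta>\<kappa> \<kappa> s)" by (simp add: mult_ac)
        then have "(N / (2 * C) / (T - s))\<^sup>2 \<le> (H1_seminorm (\<theta>\<kappa> \<kappa> s))\<^sup>2"
          using N0 C0 s by (intro power_mono) auto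
        then show "(N / (2 * C))\<^sup>2 / (T - s)\<^sup>2 \<le> (H1_seminorm (\<theta>\<kappa> \<kappa> s))\<^sup>2" by (simp add: power_divide power_mult_distrib)
      qed
    qed
    then have "I = \<infinity>" unfolding I_def using N0 C0 T by (intro nn_integral_blowup[of "(N / (2 * C))\<^sup>2"]) auto
    with small \<kappa> show False by (simp add: ennreal_mult_top top_unique)
  qed
qed

end
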